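(* Let $T$ be a complex torus of dimension $g\ge 2$. Suppose that $\mathrm{End}^0(T)$ is a number field of degree $2g$ over $\mathbb{Q}$ that does not contain a proper subfield except $\mathbb{Q}$. If $T^{\vee}$ is the dual of $T$, then $\mathrm{Hom}(T,T^{\vee})=\{0\}$. In particular, $T$ is not isogenous to $T^{\vee}$.
   Context: For complex tori $T,T'$, $\mathrm{Hom}(T,T')$ is the group of homomorphisms of complex Lie groups, $\mathrm{End}(T)=\mathrm{Hom}(T,T)$, and $\mathrm{End}^0(T)=\mathrm{End}(T)\otimes\mathbb{Q}$. The dual torus is $T^{\vee}=\mathrm{Pic}^0(T)$; explicitly, if $T=V/\Gamma$ with $V$ a $g$-dimensional complex vector space and $\Gamma$ a discrete lattice of rank $2g$, then $T^{\vee}=V^{\vee}/\Gamma^{\vee}$, where $V^{\vee}$ is the complex vector space of $\mathbb{C}$-antilinear maps $l:V\to\mathbb{C}$ and $\Gamma^{\vee}=\{l\in V^{\vee}\mid \mathrm{Im}(l(\Gamma))\subset\mathbb{Z}\}$. *)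

theory Defs
  imports "HOL-Analysis.Analysis" "HOL-Algebra.Algebra" "HOL-Algebra.Algebraic_Closure_Type"
begin

section \<open>Complex vector spaces and their antilinear duals\<close>

text \<open>
  The norm only serves to give a finite-dimensional complex vector space its (unique)
  vector space topology and the notion of derivative.
\<close>

class scaleC = scaleR +
  fixes scaleC :: "complex \<Rightarrow> 'a \<Rightarrow> 'a"  (infixr \<open>*\<^sub>C\<close> 75)

class complex_normed_vector = scaleC + real_normed_vector +
  assumes scaleC_add_right: "a *\<^sub>C (x + y) = a *\<^sub>C x + a *\<^sub>C y"
    and scaleC_add_left: "(a + b) *\<^sub>C x = a *\<^sub>C x + b *\<^sub>C x"
    and scaleC_scaleC: "a *\<^sub>C (b *\<^sub>C x) = (a * b) *\<^sub>C x"
    and scaleR_scaleC: "r *\<^sub>R x = complex_of_real r *\<^sub>C x"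
    and norm_scaleC: "norm (a *\<^sub>C x) = cmod a * norm x"

text \<open>
  The dimension function of the library returns 0 on infinite-dimensional spaces, so
  a positive value of this dimension includes finite-dimensionality.
\<close>

definition complex_dim :: "'v::complex_normed_vector itself \<Rightarrow> nat" where
  "complex_dim _ = Vector_Spaces.vector_space.dim (scaleC :: complex \<Rightarrow> 'v \<Rightarrow> 'v) UNIV"

text \<open>
  On a finite-dimensional space every antilinear map is bounded, so there this type
  consists of all antilinear maps to the complex numbers.
\<close>

typedef (overloaded) 'v antidual =
  "{l :: 'v::complex_normed_vector \<Rightarrow>\<^sub>L complex.
      \<forall>c v. blinfun_apply l (c *\<^sub>C v) = cnj c * blinfun_apply l v}"
  morphisms antidual_blinfun Abs_antidual
  by (rule exI[of _ 0]) simp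

setup_lifting type_definition_antidual

lift_definition antidual_apply :: "'v::complex_normed_vector antidual \<Rightarrow> 'v \<Rightarrow> complex"
  is blinfun_apply .

lemma antidual_apply_scaleC: "antidual_apply l (c *\<^sub>C v) = cnj c * antidual_apply l v"
  by transfer simp

lemma bounded_linear_cmult_blinfun:
  fixes l :: "'v::real_normed_vector \<Rightarrow>\<^sub>L complex"
  shows "bounded_linear (\<lambda>v. c * blinfun_apply l v)"
  by (rule bounded_linear_const_mult[OF blinfun.bounded_linear_right])

instantiation antidual :: (complex_normed_vector) real_normed_vector
begin

lift_definition zero_antidual :: "'a antidual" is 0 by simp
lift_definition plus_antidual :: "'a antidual \<Rightarrow> 'a antidual \<Rightarrow> 'a antidual" is "(+)"
  by (simp add: blinfun.add_left algebra_simps)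
lift_definition minus_antidual :: "'a antidual \<Rightarrow> 'a antidual \<Rightarrow> 'a antidual" is "(-)"
  by (simp add: blinfun.diff_left algebra_simps)
lift_definition uminus_antidual :: "'a antidual \<Rightarrow> 'a antidual" is uminus
  by (simp add: blinfun.minus_left)
lift_definition scaleR_antidual :: "real \<Rightarrow> 'a antidual \<Rightarrow> 'a antidual" is scaleR
  by (simp add: blinfun.scaleR_left)
lift_definition norm_antidual :: "'a antidual \<Rightarrow> real" is norm .

definition "dist_antidual (l :: 'a antidual) m = norm (l - m)"
definition "sgn_antidual (l :: 'a antidual) = scaleR (inverse (norm l)) l"
definition uniformity_antidual :: "('a antidual \<times> 'a antidual) filter" where
  "uniformity_antidual = (INF e\<in>{0<..}. principal {(x, y). dist x y < e})"
definition open_antidual :: "'a antidual set \<Rightarrow> bool" where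
  "open_antidual U = (\<forall>x\<in>U. \<forall>\<^sub>F (x', y) in uniformity. x' = x \<longrightarrow> y \<in> U)"

instance
proof
  fix r s :: real and x y z :: "'a antidual"
  show "x + y + z = x + (y + z)" by transfer (simp add: algebra_simps)
  show "x + y = y + x" by transfer (simp add: algebra_simps)
  show "0 + x = x" by transfer simp
  show "- x + x = 0" by transfer simp
  show "x - y = x + - y" by transfer simp
  show "r *\<^sub>R (x + y) = r *\<^sub>R x + r *\<^sub>R y" by transfer (simp add: algebra_simps)
  show "(r + s) *\<^sub>R x = r *\<^sub>R x + s *\<^sub>R x" by transfer (simp add: algebra_simps)
  show "r *\<^sub>R s *\<^sub>R x = (r * s) *\<^sub>R x" by transfer simp
  show "1 *\<^sub>R x = x" by transfer simp
  show "dist x y = norm (x - y)" by (fact dist_antidual_def)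
  show "sgn x = scaleR (inverse (norm x)) x" by (simp add: sgn_antidual_def)
  show "uniformity = (INF e\<in>{0<..}. principal {(x :: 'a antidual, y). dist x y < e})"
    by (fact uniformity_antidual_def)
  show "open U = (\<forall>x\<in>U. \<forall>\<^sub>F (x', y) in uniformity. x' = x \<longrightarrow> y \<in> U)"
    for U :: "'a antidual set" by (fact open_antidual_def)
  show "(norm x = 0) = (x = 0)" by transfer simp
  show "norm (x + y) \<le> norm x + norm y" by transfer (rule norm_triangle_ineq)
  show "norm (r *\<^sub>R x) = \<bar>r\<bar> * norm x" by transfer simp
qed

end

instantiation antidual :: (complex_normed_vector) complex_normed_vector
begin

lift_definition scaleC_antidual :: "complex \<Rightarrow> 'a antidual \<Rightarrow> 'a antidual"
  is "\<lambda>c l. Blinfun (\<lambda>v. c * blinfun_apply l v)"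
  by (simp add: bounded_linear_Blinfun_apply bounded_linear_cmult_blinfun)

instance
proof
  fix a b :: complex and r :: real and x y :: "'a antidual"
  note BA = bounded_linear_Blinfun_apply[OF bounded_linear_cmult_blinfun]
  show "a *\<^sub>C (x + y) = a *\<^sub>C x + a *\<^sub>C y"
    by transfer (rule blinfun_eqI, simp only: BA blinfun.add_left[of "Blinfun _"],
      simp add: blinfun.add_left algebra_simps)
  show "(a + b) *\<^sub>C x = a *\<^sub>C x + b *\<^sub>C x"
    by transfer (rule blinfun_eqI, simp only: BA blinfun.add_left[of "Blinfun _"],
      simp add: blinfun.add_left algebra_simps)
  show "a *\<^sub>C b *\<^sub>C x = (a * b) *\<^sub>C x"
    by transfer (rule blinfun_eqI, subst BA, subst BA, subst BA, simp)
  show "r *\<^sub>R x = complex_of_real r *\<^sub>C x"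
    by transfer (rule blinfun_eqI, simp add: BA blinfun.scaleR_left scaleR_conv_of_real)
  show "norm (a *\<^sub>C x) = cmod a * norm x"
  proof transfer
    fix a :: complex and l :: "'a \<Rightarrow>\<^sub>L complex"
    have le: "norm (Blinfun (\<lambda>v. c * blinfun_apply m v)) \<le> cmod c * norm m"
      for c and m :: "'a \<Rightarrow>\<^sub>L complex"
    proof (rule norm_blinfun_bound)
      show "0 \<le> cmod c * norm m" by simp
      show "norm (blinfun_apply (Blinfun (\<lambda>v. c * blinfun_apply m v)) v)
          \<le> cmod c * norm m * norm v" for v
        using norm_blinfun[of m v] by (simp add: BA norm_mult mult.assoc mult_left_mono)
    qed
    show "norm (Blinfun (\<lambda>v. a * blinfun_apply l v)) = cmod a * norm l"
    proof (cases "a = 0")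
      case True
      then show ?thesis using le[of a l] by simp
    next
      case False
      have "Blinfun (\<lambda>v. inverse a * blinfun_apply (Blinfun (\<lambda>v. a * blinfun_apply l v)) v) = l"
        by (rule blinfun_eqI, subst BA, subst BA, simp add: False)
      with le[of "inverse a" "Blinfun (\<lambda>v. a * blinfun_apply l v)"]
      have "cmod a * norm l \<le> norm (Blinfun (\<lambda>v. a * blinfun_apply l v))"
        using False by (simp add: norm_inverse norm_divide field_simps)
      with le[of a l] show ?thesis by simp
    qed
  qed
qed

end

lemma antidual_apply_scaleC_left: "antidual_apply (c *\<^sub>C l) v = c * antidual_apply l v"
  by transfer (simp add: bounded_linear_Blinfun_apply bounded_linear_cmult_blinfun)


section \<open>Complex tori\<close>

text \<open>
  Dependence and span are those of the integer module: a discrete subgroup that is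
  free of rank \<open>n\<close>.
\<close>

definition is_lattice :: "nat \<Rightarrow> 'v::complex_normed_vector set \<Rightarrow> bool" where
  "is_lattice n \<Gamma> \<longleftrightarrow> discrete \<Gamma> \<and>
     (\<exists>B. finite B \<and> card B = n \<and>
        \<not> Modules.module.dependent (\<lambda>(k::int) v. of_int k *\<^sub>R v) B \<and>
        Modules.module.span (\<lambda>(k::int) v. of_int k *\<^sub>R v) B = \<Gamma>)"

definition vector_group :: "'v::complex_normed_vector monoid" where
  "vector_group = \<lparr>carrier = UNIV, monoid.mult = (+), one = 0\<rparr>"

definition torus :: "'v::complex_normed_vector set \<Rightarrow> 'v set monoid" where
  "torus \<Gamma> = vector_group Mod \<Gamma>"

definition torus_proj :: "'v::complex_normed_vector set \<Rightarrow> 'v \<Rightarrow> 'v set" where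
  "torus_proj \<Gamma> v = \<Gamma> #>\<^bsub>vector_group\<^esub> v"

definition complex_differentiable_on ::
  "('v::complex_normed_vector \<Rightarrow> 'w::complex_normed_vector) \<Rightarrow> 'v set \<Rightarrow> bool" where
  "complex_differentiable_on F U \<longleftrightarrow>
     (\<forall>u\<in>U. \<exists>D. (F has_derivative D) (at u) \<and> (\<forall>c v. D (c *\<^sub>C v) = c *\<^sub>C D v))"

text \<open>
  The complex structure of a torus is the one for which the projections are local
  biholomorphisms, i.e. the charts are local inverses of the projections.  Hence a map between tori
  is holomorphic iff it is induced, near each point, by a holomorphic map of
  the covering vector spaces.
\<close>

definition torus_holomorphic ::
  "'v::complex_normed_vector set \<Rightarrow> 'w::complex_normed_vector set \<Rightarrow> ('v set \<Rightarrow> 'w set) \<Rightarrow> bool" where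
  "torus_holomorphic \<Gamma> \<Gamma>' f \<longleftrightarrow>
     (\<forall>x. \<exists>U F. open U \<and> x \<in> U \<and> complex_differentiable_on F U \<and>
        (\<forall>u\<in>U. f (torus_proj \<Gamma> u) = torus_proj \<Gamma>' (F u)))"

text \<open>
  Homomorphisms are extensional (undefined outside the carrier), so that equality of
  homomorphisms is equality of functions.
\<close>

definition torus_Hom ::
  "'v::complex_normed_vector set \<Rightarrow> 'w::complex_normed_vector set \<Rightarrow> ('v set \<Rightarrow> 'w set) set" where
  "torus_Hom \<Gamma> \<Gamma>' =
     {f \<in> hom (torus \<Gamma>) (torus \<Gamma>') \<inter> extensional (carrier (torus \<Gamma>)). torus_holomorphic \<Gamma> \<Gamma>' f}"

definition torus_zero_hom ::
  "'v::complex_normed_vector set \<Rightarrow> 'w::complex_normed_vector set \<Rightarrow> 'v set \<Rightarrow> 'w set" where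
  "torus_zero_hom \<Gamma> \<Gamma>' = (\<lambda>x\<in>carrier (torus \<Gamma>). \<one>\<^bsub>torus \<Gamma>'\<^esub>)"

definition torus_isogenous ::
  "'v::complex_normed_vector set \<Rightarrow> 'w::complex_normed_vector set \<Rightarrow> bool" where
  "torus_isogenous \<Gamma> \<Gamma>' \<longleftrightarrow>
     (\<exists>f\<in>torus_Hom \<Gamma> \<Gamma>'. f ` carrier (torus \<Gamma>) = carrier (torus \<Gamma>') \<and>
        finite (kernel (torus \<Gamma>) (torus \<Gamma>') f))"

text \<open>
  The dual torus of \<open>V / \<Gamma>\<close> is the torus of this lattice in the antilinear dual of \<open>V\<close>.
\<close>

definition dual_lattice :: "'v::complex_normed_vector set \<Rightarrow> 'v antidual set" where
  "dual_lattice \<Gamma> = {l. \<forall>\<gamma>\<in>\<Gamma>. Im (antidual_apply l \<gamma>) \<in> \<int>}"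

definition torus_End :: "'v::complex_normed_vector set \<Rightarrow> ('v set \<Rightarrow> 'v set) ring" where
  "torus_End \<Gamma> =
     \<lparr>carrier = torus_Hom \<Gamma> \<Gamma>,
      monoid.mult = (\<lambda>f h. compose (carrier (torus \<Gamma>)) f h),
      one = (\<lambda>x\<in>carrier (torus \<Gamma>). x),
      ring.zero = torus_zero_hom \<Gamma> \<Gamma>,
      add = (\<lambda>f h. \<lambda>x\<in>carrier (torus \<Gamma>). f x \<otimes>\<^bsub>torus \<Gamma>\<^esub> h x)\<rparr>"


section \<open>Tensor products of rings over the integers\<close>

text \<open>
  The tensor product of two rings is the free abelian group on pairs, with the
  multiplication extending \<open>(a, b) \<cdot> (a', b') = (a a', b b')\<close> biadditively, modulo the
  ideal generated by the biadditivity relations.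
\<close>

definition free_pair_ring ::
  "('a, 'm) ring_scheme \<Rightarrow> ('b, 'n) ring_scheme \<Rightarrow> (('a \<times> 'b) \<Rightarrow>\<^sub>0 int) ring" where
  "free_pair_ring A B =
     \<lparr>carrier = {c. Poly_Mapping.keys c \<subseteq> carrier A \<times> carrier B},
      monoid.mult = (\<lambda>c d. frag_extend (\<lambda>(a, b).
         frag_extend (\<lambda>(a', b'). frag_of (a \<otimes>\<^bsub>A\<^esub> a', b \<otimes>\<^bsub>B\<^esub> b')) d) c),
      one = frag_of (\<one>\<^bsub>A\<^esub>, \<one>\<^bsub>B\<^esub>),
      ring.zero = 0,
      add = (+)\<rparr>"

definition biadditivity_relations ::
  "('a, 'm) ring_scheme \<Rightarrow> ('b, 'n) ring_scheme \<Rightarrow> (('a \<times> 'b) \<Rightarrow>\<^sub>0 int) set" where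
  "biadditivity_relations A B =
     {frag_of (a \<oplus>\<^bsub>A\<^esub> a', b) - frag_of (a, b) - frag_of (a', b) | a a' b.
        a \<in> carrier A \<and> a' \<in> carrier A \<and> b \<in> carrier B} \<union>
     {frag_of (a, b \<oplus>\<^bsub>B\<^esub> b') - frag_of (a, b) - frag_of (a, b') | a b b'.
        a \<in> carrier A \<and> b \<in> carrier B \<and> b' \<in> carrier B}"

definition tensor_ideal ::
  "('a, 'm) ring_scheme \<Rightarrow> ('b, 'n) ring_scheme \<Rightarrow> (('a \<times> 'b) \<Rightarrow>\<^sub>0 int) set" where
  "tensor_ideal A B = genideal (free_pair_ring A B) (biadditivity_relations A B)"

definition tensor_ring ::
  "('a, 'm) ring_scheme \<Rightarrow> ('b, 'n) ring_scheme \<Rightarrow> (('a \<times> 'b) \<Rightarrow>\<^sub>0 int) set ring" where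
  "tensor_ring A B = free_pair_ring A B Quot tensor_ideal A B"

definition pure_tensor ::
  "('a, 'm) ring_scheme \<Rightarrow> ('b, 'n) ring_scheme \<Rightarrow> 'a \<Rightarrow> 'b \<Rightarrow> (('a \<times> 'b) \<Rightarrow>\<^sub>0 int) set" where
  "pure_tensor A B a b = tensor_ideal A B +>\<^bsub>free_pair_ring A B\<^esub> frag_of (a, b)"


section \<open>The endomorphism algebra\<close>

definition torus_End0 ::
  "'v::complex_normed_vector set \<Rightarrow> ((('v set \<Rightarrow> 'v set) \<times> rat) \<Rightarrow>\<^sub>0 int) set ring" where
  "torus_End0 \<Gamma> = tensor_ring (torus_End \<Gamma>) (ring_of_type_algebra :: rat ring)"

text \<open>
  The copy of the rational numbers in the endomorphism algebra: the elements \<open>1 \<otimes> q\<close>.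
\<close>

definition torus_End0_rat ::
  "'v::complex_normed_vector set \<Rightarrow> ((('v set \<Rightarrow> 'v set) \<times> rat) \<Rightarrow>\<^sub>0 int) set set" where
  "torus_End0_rat \<Gamma> =
     range (\<lambda>q. pure_tensor (torus_End \<Gamma>) (ring_of_type_algebra :: rat ring) \<one>\<^bsub>torus_End \<Gamma>\<^esub> q)"

end

theory Submission
  imports Defs
begin

text \<open>
  Write \<open>E\<close> for the image of \<open>End\<^sup>0(T)\<close> in the complex linear endomorphisms of \<open>V\<close> and \<open>W = \<Gamma> \<otimes> \<rat>\<close>.
  By dimension, \<open>W\<close> is a one-dimensional vector space over the field \<open>E\<close>.  A homomorphism from \<open>T\<close>
  to its dual lifts to a complex linear map \<open>L\<close> from \<open>V\<close> to its antilinear dual, and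
  \<open>\<beta> x y = Im (L x y)\<close> is a rational bilinear form on \<open>W\<close> for which multiplication by \<open>\<i>\<close> is
  skew-adjoint.  Multiplication by \<open>\<i>\<close> lies in \<open>E \<otimes> \<real>\<close>; applying a suitable rational functional to its
  real coordinates gives a non-rational \<open>a\<close> in \<open>E\<close> that is skew-adjoint for \<open>\<beta>\<close>.  The self-adjoint
  elements of \<open>E\<close> form a subfield.  If it is \<open>E\<close>, then \<open>a\<close> is both self-adjoint and skew-adjoint, so
  \<open>\<beta> = 0\<close>.  If it is \<open>\<rat>\<close>, then \<open>a\<^sup>2\<close> is rational, so \<open>\<rat>(a)\<close> is a quadratic subfield and
  must be \<open>E\<close>, contradicting \<open>2 g > 2\<close>.
\<close>

section \<open>Rational bilinear forms over a field without intermediate fields\<close>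

definition complex_linear :: "('v::complex_normed_vector \<Rightarrow> 'w::complex_normed_vector) \<Rightarrow> bool" where
  "complex_linear f \<longleftrightarrow> (\<forall>x y. f (x + y) = f x + f y) \<and> (\<forall>c x. f (c *\<^sub>C x) = c *\<^sub>C f x)"

lemma complex_linear_imp_linear: "complex_linear f \<Longrightarrow> linear f"
  by (rule linearI) (simp_all add: complex_linear_def scaleR_scaleC)

lemma scaleC_zero_right: "c *\<^sub>C (0::'v::complex_normed_vector) = 0"
  using scaleC_add_right[of c "0::'v" 0] by simp

lemma complex_linear_id: "complex_linear (\<lambda>x. x)"
  and complex_linear_zero: "complex_linear (\<lambda>x. 0)"
  and complex_linear_compose: "complex_linear f \<Longrightarrow> complex_linear h \<Longrightarrow> complex_linear (\<lambda>x. f (h x))"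
  by (simp_all add: complex_linear_def scaleC_zero_right)

lemma complex_linear_add:
  "complex_linear f \<Longrightarrow> complex_linear h \<Longrightarrow> complex_linear (\<lambda>x. f x + h x)"
  by (simp add: complex_linear_def scaleC_add_right)

lemma complex_linear_scaleR: "complex_linear f \<Longrightarrow> complex_linear (\<lambda>x. r *\<^sub>R f x)"
  by (simp add: complex_linear_def scaleR_scaleC scaleC_scaleC scaleC_add_right mult.commute)

lemma complex_linear_diff:
  "complex_linear f \<Longrightarrow> complex_linear h \<Longrightarrow> complex_linear (\<lambda>x. f x - h x)"
  using complex_linear_add[of f "\<lambda>x. (-1) *\<^sub>R h x"] complex_linear_scaleR[of h "-1"] by simp

text \<open>An element of \<open>T\<close> outside \<open>span S\<close> would enlarge
  \<open>S\<close> to an independent subset of \<open>span T\<close> with more than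
  \<open>card T\<close> elements. The setting is a general vector space because the fact is applied
  over the rationals and over the reals.\<close>

lemma (in vector_space) span_subset_of_card_le:
  assumes S: "independent S" and T: "finite T" and ST: "S \<subseteq> span T" and card: "card T \<le> card S"
  shows "span T \<subseteq> span S"
proof (rule span_minimal)
  have fS: "finite S" using independent_span_bound[OF T S ST] by simp
  show "T \<subseteq> span S"
  proof
    fix t assume t: "t \<in> T"
    show "t \<in> span S"
    proof (rule ccontr)
      assume n: "t \<notin> span S"
      then have "independent (insert t S)" using S by (rule independent_insertI)
      moreover have "insert t S \<subseteq> span T" using ST t by (simp add: span_base)
      ultimately have "card (insert t S) \<le> card T" using independent_span_bound[OF T] by blast
      moreover have "t \<notin> S" using n span_base by blast
      ultimately show False using fS card by simp
    qed
  qed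
qed (rule subspace_span)

section \<open>Rational structure of a real vector space\<close>

interpretation rat_vs: vector_space "\<lambda>(q::rat) (v::'a::real_vector). of_rat q *\<^sub>R v"
  by unfold_locales (simp_all add: scaleR_add_right scaleR_add_left of_rat_add of_rat_mult)

lemma rat_span_subset_real_span: "rat_vs.span S \<subseteq> span S"
  by (rule rat_vs.span_minimal)
     (auto simp: rat_vs.subspace_def span_base span_add span_scale span_zero)

lemma real_independent_imp_rat_independent:
  fixes S :: "'a::real_vector set"
  assumes "independent S" shows "rat_vs.independent S"
proof
  assume "rat_vs.dependent S"
  then obtain a where a: "a \<in> S" "a \<in> rat_vs.span (S - {a})" by (auto simp: rat_vs.dependent_def)
  then have "a \<in> span (S - {a})" using rat_span_subset_real_span by blast
  with a assms show False by (auto simp: dependent_def)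
qed

text \<open>\<open>E\<close> models the endomorphism field acting on \<open>V\<close>,
  \<open>B\<close> a lattice basis, and \<open>rat_vs.span B\<close> the rational lattice
  \<open>W\<close>. \<open>orbit_E\<close> says that \<open>W\<close> is a line over
  \<open>E\<close> generated by \<open>v0\<close>. \<open>subfields_E\<close> expresses the absence
  of intermediate fields through closure conditions on sets of maps, so that \<open>E\<close> can be
  handled without a separate ring structure.\<close>

locale simple_field_action =
  fixes E :: "('v::complex_normed_vector \<Rightarrow> 'v) set" and B :: "'v set" and v0 :: 'v
  assumes finite_B: "finite B" and card_B: "card B > 2"
    and independent_B: "independent B" and v0: "v0 \<in> B"
    and lin: "f \<in> E \<Longrightarrow> complex_linear f"
    and id_E: "(\<lambda>x. x) \<in> E"
    and add_E: "f \<in> E \<Longrightarrow> h \<in> E \<Longrightarrow> (\<lambda>x. f x + h x) \<in> E"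
    and scale_E: "f \<in> E \<Longrightarrow> (\<lambda>x. of_rat q *\<^sub>R f x) \<in> E"
    and compose_E: "f \<in> E \<Longrightarrow> h \<in> E \<Longrightarrow> (\<lambda>x. f (h x)) \<in> E"
    and commute_E: "f \<in> E \<Longrightarrow> h \<in> E \<Longrightarrow> f (h x) = h (f x)"
    and inverse_E: "f \<in> E \<Longrightarrow> f \<noteq> (\<lambda>x. 0) \<Longrightarrow> \<exists>h\<in>E. \<forall>x. f (h x) = x"
    and orbit_E: "(\<lambda>f. f v0) ` E = rat_vs.span B"
    and subfields_E: "\<lbrakk>K \<subseteq> E; (\<lambda>x. x) \<in> K;
      \<And>f h. f \<in> K \<Longrightarrow> h \<in> K \<Longrightarrow> (\<lambda>x. f x + h x) \<in> K;
      \<And>f q. f \<in> K \<Longrightarrow> (\<lambda>x. of_rat q *\<^sub>R f x) \<in> K;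
      \<And>f h. f \<in> K \<Longrightarrow> h \<in> K \<Longrightarrow> (\<lambda>x. f (h x)) \<in> K;
      \<And>f h. f \<in> K \<Longrightarrow> h \<in> E \<Longrightarrow> (\<forall>x. f (h x) = x) \<Longrightarrow> h \<in> K\<rbrakk> \<Longrightarrow>
      K = range (\<lambda>q x. of_rat q *\<^sub>R x) \<or> K = E"
begin

lemma v0_nonzero: "v0 \<noteq> 0"
  using independent_B v0 dependent_zero by blast

lemma sum_E:
  assumes "finite A" "\<And>a. a \<in> A \<Longrightarrow> f a \<in> E"
  shows "(\<lambda>x. \<Sum>a\<in>A. of_rat (q a) *\<^sub>R f a x) \<in> E"
  using assms
proof (induction A rule: finite_induct)
  case empty
  show ?case using scale_E[OF id_E, of 0] by simp
next
  case (insert a A)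
  then show ?case using add_E[OF scale_E[of "f a" "q a"]] by simp
qed

lemma orbit_mem: "f \<in> E \<Longrightarrow> x \<in> rat_vs.span B \<Longrightarrow> f x \<in> rat_vs.span B"
proof -
  assume f: "f \<in> E" and "x \<in> rat_vs.span B"
  then obtain k where k: "k \<in> E" "x = k v0" unfolding orbit_E[symmetric] by blast
  show "f x \<in> rat_vs.span B" unfolding orbit_E[symmetric] k(2)
    by (rule image_eqI[OF _ compose_E[OF f k(1)]]) (rule refl)
qed

lemma orbit_ex: "x \<in> rat_vs.span B \<Longrightarrow> \<exists>f\<in>E. f v0 = x"
  by (auto simp flip: orbit_E)

text \<open>Every point of \<open>W\<close> is \<open>k v0\<close> with \<open>k\<close> in
  \<open>E\<close>, and commutativity moves \<open>k\<close> past \<open>f\<close>, so the value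
  \<open>f v0\<close> fixes \<open>f\<close> on \<open>W\<close>.\<close>

lemma orbit_determines:
  assumes "f \<in> E" "h \<in> E" "f v0 = h v0" "x \<in> rat_vs.span B" shows "f x = h x"
proof -
  obtain k where k: "k \<in> E" "k v0 = x" using orbit_ex assms by blast
  have "f (k v0) = k (f v0)" "h (k v0) = k (h v0)"
    using commute_E k assms by blast+
  then show ?thesis using k assms by simp
qed

text \<open>Multiplication by \<open>\<i>\<close> commutes with \<open>E\<close>, hence it is a real linear combination of elements
  of \<open>E\<close>, with coefficients that can be read off at \<open>v0\<close>.\<close>

lemma imaginary_unit_expansion:
  assumes "\<i> *\<^sub>C v0 \<in> span B"
  obtains r e where "\<And>b. b \<in> B \<Longrightarrow> e b \<in> E" "\<And>b. b \<in> B \<Longrightarrow> e b v0 = b"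
    "\<And>y. y \<in> rat_vs.span B \<Longrightarrow> \<i> *\<^sub>C y = (\<Sum>b\<in>B. r b *\<^sub>R e b y)"
proof -
  obtain r where r: "\<i> *\<^sub>C v0 = (\<Sum>b\<in>B. r b *\<^sub>R b)"
    using assms by (auto simp: span_finite[OF finite_B])
  have "\<forall>b\<in>B. \<exists>f\<in>E. f v0 = b" using orbit_ex rat_vs.span_base by blast
  then obtain e where e: "\<And>b. b \<in> B \<Longrightarrow> e b \<in> E" "\<And>b. b \<in> B \<Longrightarrow> e b v0 = b" by metis
  have "\<i> *\<^sub>C y = (\<Sum>b\<in>B. r b *\<^sub>R e b y)" if y: "y \<in> rat_vs.span B" for y
  proof -
    \<comment> \<open>The complex linear map \<open>k\<close> is applied to the expansion of
      \<open>\<i> *\<^sub>C v0\<close>; commutativity turns \<open>k (e b v0)\<close> into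
      \<open>e b y\<close>.\<close>
    obtain k where k: "k \<in> E" "k v0 = y" using orbit_ex y by blast
    interpret k: linear k using lin[OF k(1)] by (rule complex_linear_imp_linear)
    have "\<i> *\<^sub>C y = k (\<i> *\<^sub>C v0)" using k lin[OF k(1)] by (simp add: complex_linear_def)
    also have "\<dots> = (\<Sum>b\<in>B. r b *\<^sub>R k (e b v0))" by (simp add: r k.sum k.scaleR e)
    also have "\<dots> = (\<Sum>b\<in>B. r b *\<^sub>R e b y)"
      by (intro sum.cong refl) (simp add: commute_E[OF k(1) e(1)] k(2))
    finally show ?thesis .
  qed
  with e that show thesis by blast
qed

end

text \<open>The set \<open>{c}\<close> is independent over the rationals, so the prescription
  \<open>c\<close> to 1 extends to a rational linear functional on the reals. Such a functional
  turns a relation with rational coefficients between real numbers into one between rational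
  numbers.\<close>

lemma rat_functional_exists:
  fixes c :: real assumes "c \<noteq> 0"
  obtains l :: "real \<Rightarrow> rat" where "\<And>A t r. l (\<Sum>a\<in>A. of_rat (t a) * r a) = (\<Sum>a\<in>A. t a * l (r a))" "l c = 1"
proof -
  interpret P: vector_space_pair "\<lambda>(q::rat) (v::real). of_rat q *\<^sub>R v" "(*) :: rat \<Rightarrow> rat \<Rightarrow> rat"
    by unfold_locales (simp_all add: algebra_simps)
  have indep: "rat_vs.independent {c}" using assms rat_vs.dependent_single by blast
  obtain l where l: "Vector_Spaces.linear (\<lambda>(q::rat) (v::real). of_rat q *\<^sub>R v) ((*) :: rat \<Rightarrow> rat \<Rightarrow> rat) l"
      "l c = 1"
    using P.linear_independent_extend[OF indep, of "\<lambda>_. 1"] by blast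
  interpret l: Vector_Spaces.linear "\<lambda>(q::rat) (v::real). of_rat q *\<^sub>R v" "(*) :: rat \<Rightarrow> rat \<Rightarrow> rat" l
    by (rule l)
  have "l (\<Sum>a\<in>A. of_rat (t a) * r a) = (\<Sum>a\<in>A. t a * l (r a))" for A :: "'a set" and t r
    using l.sum[of "\<lambda>a. of_rat (t a) * r a" A] l.scale by simp
  with l that show thesis by blast
qed

context simple_field_action
begin

text \<open>On \<open>W\<close>, multiplication by \<open>\<i>\<close> is a combination of the maps
  \<open>e b\<close> with real coefficients \<open>r b\<close>. For each pair \<open>x\<close>,
  \<open>y\<close> its skewness is a relation with rational coefficients between the numbers
  \<open>r b\<close>. A rational functional \<open>l\<close> preserves all these relations, so
  replacing \<open>r b\<close> by \<open>l (r b)\<close> gives an element of \<open>E\<close> that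
  is still skew-adjoint.\<close>

lemma skew_adjoint_exists:
  fixes \<beta> :: "'v \<Rightarrow> 'v \<Rightarrow> real"
  assumes span_B: "span B = UNIV" and bil: "bilinear \<beta>"
    and skew: "\<And>x y. \<beta> (\<i> *\<^sub>C x) y = - \<beta> x (\<i> *\<^sub>C y)"
    and rat: "\<And>x y. x \<in> rat_vs.span B \<Longrightarrow> y \<in> rat_vs.span B \<Longrightarrow> \<beta> x y \<in> \<rat>"
  obtains a where "a \<in> E" "a v0 \<notin> rat_vs.span {v0}"
    "\<And>x y. x \<in> rat_vs.span B \<Longrightarrow> y \<in> rat_vs.span B \<Longrightarrow> \<beta> (a x) y = - \<beta> x (a y)"
proof -
  obtain r e where e: "\<And>b. b \<in> B \<Longrightarrow> e b \<in> E" "\<And>b. b \<in> B \<Longrightarrow> e b v0 = b"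
    and i: "\<And>y. y \<in> rat_vs.span B \<Longrightarrow> \<i> *\<^sub>C y = (\<Sum>b\<in>B. r b *\<^sub>R e b y)"
    by (rule imaginary_unit_expansion) (use span_B in auto)
  have iv0: "\<i> *\<^sub>C v0 = (\<Sum>b\<in>B. r b *\<^sub>R b)"
    using i[of v0] e v0 rat_vs.span_base by (auto intro: sum.cong)
  \<comment> \<open>Multiplication by \<open>\<i>\<close> does not send \<open>v0\<close> to a real
    multiple of itself, so some coordinate away from \<open>v0\<close> is nonzero. Normalising
    \<open>l\<close> there keeps \<open>a\<close> from being rational.\<close>
  obtain c where c: "c \<in> B" "c \<noteq> v0" "r c \<noteq> 0"
  proof (rule ccontr)
    assume "\<not> thesis"
    with that have "\<And>b. b \<in> B \<Longrightarrow> b \<noteq> v0 \<Longrightarrow> r b = 0" by blast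
    then have "\<i> *\<^sub>C v0 = (\<Sum>b\<in>{v0}. r b *\<^sub>R b)"
      unfolding iv0 by (intro sum.mono_neutral_right) (use finite_B v0 in auto)
    then have "\<i> *\<^sub>C v0 = complex_of_real (r v0) *\<^sub>C v0" by (simp add: scaleR_scaleC)
    \<comment> \<open>The scalar \<open>\<i> - r v0\<close> would annihilate the nonzero
      \<open>v0\<close>, hence be zero, although its imaginary part is 1.\<close>
    then have "(\<i> + - complex_of_real (r v0)) *\<^sub>C v0 = complex_of_real (r v0) *\<^sub>C v0 + (- complex_of_real (r v0)) *\<^sub>C v0"
      by (simp only: scaleC_add_left)
    also have "\<dots> = 0"
      by (metis add.right_inverse norm_eq_zero norm_scaleC norm_zero mult_zero_left scaleC_add_left)
    finally have "cmod (\<i> + - complex_of_real (r v0)) * norm v0 = 0"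
      by (metis norm_scaleC norm_zero)
    then show False using v0_nonzero by (auto simp: complex_eq_iff)
  qed
  obtain l :: "real \<Rightarrow> rat" where l: "\<And>A t r. l (\<Sum>a\<in>A. of_rat (t a) * r a) = (\<Sum>a\<in>(A::'v set). t a * l (r a))"
      "l (r c) = 1"
    using rat_functional_exists[OF c(3)] by blast
  define a where "a x = (\<Sum>b\<in>B. of_rat (l (r b)) *\<^sub>R e b x)" for x
  show thesis
  proof
    show "a \<in> E" unfolding a_def[abs_def] by (rule sum_E) (use finite_B e in auto)
    have av0: "a v0 = (\<Sum>b\<in>B. of_rat (l (r b)) *\<^sub>R b)" using e by (simp add: a_def)
    \<comment> \<open>The coefficient of \<open>c\<close> in \<open>a v0\<close> is
      \<open>l (r c) = 1\<close>. If \<open>a v0\<close> were a multiple of \<open>v0\<close>, then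
      \<open>c\<close> would lie in the real span of the other basis vectors.\<close>
    show "a v0 \<notin> rat_vs.span {v0}"
    proof
      assume "a v0 \<in> rat_vs.span {v0}"
      then have 1: "a v0 \<in> span (B - {c})"
        using rat_span_subset_real_span[of "{v0}"] span_mono[of "{v0}" "B - {c}"] c v0 by blast
      have "a v0 = c + (\<Sum>b\<in>B-{c}. of_rat (l (r b)) *\<^sub>R b)"
        unfolding av0 using sum.remove[OF finite_B c(1), of "\<lambda>b. of_rat (l (r b)) *\<^sub>R b"] by (simp add: l(2))
      then have "c = a v0 - (\<Sum>b\<in>B-{c}. of_rat (l (r b)) *\<^sub>R b)" by simp
      also have "\<dots> \<in> span (B - {c})"
        by (intro span_diff 1 span_sum span_scale span_base)
      finally show False using independent_B c(1) dependent_def by blast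
    qed
  next
    fix x y assume x: "x \<in> rat_vs.span B" and y: "y \<in> rat_vs.span B"
    interpret b1: linear "\<lambda>x. \<beta> x y" using bil by (simp add: bilinear_def)
    interpret b2: linear "\<lambda>y. \<beta> x y" using bil by (simp add: bilinear_def)
    have "\<beta> (e b x) y + \<beta> x (e b y) \<in> \<rat>" if "b \<in> B" for b
      by (intro Rats_add rat orbit_mem[OF e(1)] that x y)
    then have "\<forall>b\<in>B. \<exists>t. \<beta> (e b x) y + \<beta> x (e b y) = of_rat t" by (metis Rats_cases)
    then obtain t where t: "\<And>b. b \<in> B \<Longrightarrow> \<beta> (e b x) y + \<beta> x (e b y) = of_rat (t b)" by metis
    have "0 = \<beta> (\<i> *\<^sub>C x) y + \<beta> x (\<i> *\<^sub>C y)" using skew by simp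
    also have "\<dots> = (\<Sum>b\<in>B. of_rat (t b) * r b)"
      unfolding i[OF x] i[OF y] b1.sum b2.sum b1.scaleR b2.scaleR sum.distrib[symmetric]
      using t by (intro sum.cong) (auto simp: algebra_simps simp flip: t)
    \<comment> \<open>Writing 0 as a combination with coefficients \<open>of_rat 0\<close> lets the
      same rule for \<open>l\<close> evaluate both sides.\<close>
    finally have "l (\<Sum>b\<in>B. of_rat (t b) * r b) = l (\<Sum>b\<in>B. of_rat 0 * r b)" by simp
    then have "(\<Sum>b\<in>B. t b * l (r b)) = 0" unfolding l by simp
    then have "0 = real_of_rat (\<Sum>b\<in>B. t b * l (r b))" by simp
    also have "\<dots> = (\<Sum>b\<in>B. of_rat (l (r b)) * of_rat (t b))" by (simp add: of_rat_sum of_rat_mult mult.commute)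
    also have "\<dots> = \<beta> (a x) y + \<beta> x (a y)"
      unfolding a_def b1.sum b2.sum b1.scaleR b2.scaleR sum.distrib[symmetric]
      by (intro sum.cong) (auto simp: algebra_simps simp flip: t)
    finally show "\<beta> (a x) y = - \<beta> x (a y)" by simp
  qed
qed

text \<open>The hypothesis \<open>skew\<close> is the property that the imaginary part inherits from
  a form that is complex linear in the first and antilinear in the second argument.\<close>

lemma rational_sesquilinear_form_zero:
  fixes \<beta> :: "'v \<Rightarrow> 'v \<Rightarrow> real"
  assumes span_B: "span B = UNIV" and bil: "bilinear \<beta>"
    and skew: "\<And>x y. \<beta> (\<i> *\<^sub>C x) y = - \<beta> x (\<i> *\<^sub>C y)"
    and rat: "\<And>x y. x \<in> rat_vs.span B \<Longrightarrow> y \<in> rat_vs.span B \<Longrightarrow> \<beta> x y \<in> \<rat>"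
    and x: "x \<in> rat_vs.span B" and y: "y \<in> rat_vs.span B"
  shows "\<beta> x y = 0"
proof -
  define W where "W = rat_vs.span B"
  obtain a where a: "a \<in> E" "a v0 \<notin> rat_vs.span {v0}"
    and adj: "\<And>x y. x \<in> W \<Longrightarrow> y \<in> W \<Longrightarrow> \<beta> (a x) y = - \<beta> x (a y)"
    using skew_adjoint_exists[OF span_B bil skew rat] unfolding W_def by metis
  have W: "f x \<in> W" if "f \<in> E" "x \<in> W" for f x using orbit_mem that W_def by blast
  interpret a: linear a using lin[OF a(1)] by (rule complex_linear_imp_linear)
  note bil_simps = bilinear_ladd[OF bil] bilinear_radd[OF bil] bilinear_lmul[OF bil] bilinear_rmul[OF bil]
  define F where "F = {f\<in>E. \<forall>x\<in>W. \<forall>y\<in>W. \<beta> (f x) y = \<beta> x (f y)}"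
  have F_E: "F = range (\<lambda>q x. of_rat q *\<^sub>R x) \<or> F = E"
  proof (rule subfields_E)
    fix f h assume "f \<in> F" "h \<in> F"
    then have fE: "f \<in> E" "h \<in> E" and f: "\<And>x y. x \<in> W \<Longrightarrow> y \<in> W \<Longrightarrow> \<beta> (f x) y = \<beta> x (f y)"
      and h: "\<And>x y. x \<in> W \<Longrightarrow> y \<in> W \<Longrightarrow> \<beta> (h x) y = \<beta> x (h y)" by (auto simp: F_def)
    show "(\<lambda>x. f x + h x) \<in> F" using f h fE add_E by (simp add: F_def bil_simps)
    \<comment> \<open>Passing to adjoints reverses a product; commutativity of \<open>E\<close>
      restores the order.\<close>
    show "(\<lambda>x. f (h x)) \<in> F"
      using f h fE compose_E commute_E[OF fE] W by (simp add: F_def)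
  next
    fix f h assume "f \<in> F" and hE: "h \<in> E" and inv: "\<forall>x. f (h x) = x"
    then have fE: "f \<in> E" and f: "\<And>x y. x \<in> W \<Longrightarrow> y \<in> W \<Longrightarrow> \<beta> (f x) y = \<beta> x (f y)"
      by (auto simp: F_def)
    \<comment> \<open>Self-adjointness of \<open>f\<close> is applied to the preimages
      \<open>h x\<close> and \<open>h y\<close>.\<close>
    have "\<beta> (h x) y = \<beta> x (h y)" if "x \<in> W" "y \<in> W" for x y
      using f[of "h x" "h y"] W[OF hE] that inv by simp
    then show "h \<in> F" using hE by (simp add: F_def)
  qed (auto simp: F_def id_E scale_E bil_simps)
  then show ?thesis
  proof
    assume FE: "F = E"
    have "a \<noteq> (\<lambda>x. 0)" using a(2) rat_vs.span_zero by force
    \<comment> \<open>Since \<open>a (h y) = y\<close>, pairing \<open>a x\<close> with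
      \<open>h y\<close> yields both \<open>\<beta> x y\<close> and its negative.\<close>
    then obtain h where h: "h \<in> E" "\<And>x. a (h x) = x" using inverse_E a(1) by blast
    have hy: "h y \<in> W" using W h y by (simp add: W_def)
    have "\<beta> (a x) (h y) = \<beta> x (a (h y))" using a(1) FE F_def x hy W_def by blast
    moreover have "\<beta> (a x) (h y) = - \<beta> x (a (h y))" using adj x hy W_def by blast
    ultimately show ?thesis using h by simp
  next
    assume FQ: "F = range (\<lambda>q x. of_rat q *\<^sub>R x)"
    \<comment> \<open>Moving \<open>a\<close> across twice cancels the signs, so the square of
      \<open>a\<close> is self-adjoint and hence a rational scalar \<open>s\<close>.\<close>
    have "(\<lambda>x. a (a x)) \<in> F" using a compose_E W by (simp add: F_def adj)
    then obtain s where "(\<lambda>x. a (a x)) = (\<lambda>x. of_rat s *\<^sub>R x)" using FQ by blast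
    then have s: "a (a x) = of_rat s *\<^sub>R x" for x by metis
    \<comment> \<open>\<open>K\<close> plays the role of the field generated by \<open>a\<close>,
      described by values at \<open>v0\<close>. Since the square of \<open>a\<close> is rational,
      its members act on \<open>W\<close> as combinations \<open>p + q a\<close>.\<close>
    define K where "K = {f\<in>E. f v0 \<in> rat_vs.span {v0, a v0}}"
    have KI: "(\<lambda>x. of_rat p *\<^sub>R x + of_rat q *\<^sub>R a x) \<in> E" for p q
      using add_E[OF scale_E[OF id_E, of p] scale_E[OF a(1), of q]] .
    have Kmem: "f \<in> E \<Longrightarrow> f v0 = of_rat p *\<^sub>R v0 + of_rat q *\<^sub>R a v0 \<Longrightarrow> f \<in> K" for f p q
      by (simp add: K_def rat_vs.span_add rat_vs.span_scale rat_vs.span_base)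
    have Kex: "\<exists>p q. f v0 = of_rat p *\<^sub>R v0 + of_rat q *\<^sub>R a v0" if "f \<in> K" for f
    proof -
      from that obtain p where "f v0 - of_rat p *\<^sub>R v0 \<in> rat_vs.span {a v0}"
        by (auto simp: K_def rat_vs.span_breakdown_eq[of _ v0])
      then obtain q where "f v0 - of_rat p *\<^sub>R v0 = of_rat q *\<^sub>R a v0" 
        by (auto simp: rat_vs.span_breakdown_eq)
      then show ?thesis by (metis add.commute diff_add_cancel)
    qed
    have v0W: "v0 \<in> W" using v0 rat_vs.span_base W_def by blast
    have Kmult: "f x = of_rat p *\<^sub>R x + of_rat q *\<^sub>R a x"
      if "f \<in> K" "f v0 = of_rat p *\<^sub>R v0 + of_rat q *\<^sub>R a v0" "x \<in> W" for f p q x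
      using orbit_determines[of f "\<lambda>x. of_rat p *\<^sub>R x + of_rat q *\<^sub>R a x" x] that KI
      by (simp add: K_def W_def)
    have "K = range (\<lambda>q x. of_rat q *\<^sub>R x) \<or> K = E"
    proof (rule subfields_E)
      fix f h assume fK: "f \<in> K" and hK: "h \<in> K"
      then have fE: "f \<in> E" "h \<in> E" by (auto simp: K_def)
      show "(\<lambda>x. f x + h x) \<in> K" using fK hK by (simp add: K_def add_E rat_vs.span_add)
      obtain p q where f: "f v0 = of_rat p *\<^sub>R v0 + of_rat q *\<^sub>R a v0" using Kex fK by blast
      obtain p' q' where h: "h v0 = of_rat p' *\<^sub>R v0 + of_rat q' *\<^sub>R a v0" using Kex hK by blast
      have "f (h v0) = of_rat (p * p' + q * q' * s) *\<^sub>R v0 + of_rat (p * q' + q * p') *\<^sub>R a v0"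
        using Kmult[OF fK f W[OF fE(2) v0W]]
        by (simp add: h a.add a.scaleR s of_rat_add of_rat_mult algebra_simps)
      then show "(\<lambda>x. f (h x)) \<in> K" by (rule Kmem[OF compose_E[OF fE]])
    next
      fix f h assume fK: "f \<in> K" and hE: "h \<in> E" and inv: "\<forall>x. f (h x) = x"
      have fE: "f \<in> E" using fK by (simp add: K_def)
      obtain p q where f: "f v0 = of_rat p *\<^sub>R v0 + of_rat q *\<^sub>R a v0" using Kex fK by blast
      define n where "n = p * p - q * q * s"
      text \<open>The conjugate \<open>p v0 - q a v0\<close> of \<open>f v0\<close> gives the inverse up to the norm \<open>n\<close>.\<close>
      let ?k = "\<lambda>x. of_rat p *\<^sub>R x + of_rat (-q) *\<^sub>R a x"
      have k: "?k \<in> E" by (rule KI)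
      have "?k (f v0) = of_rat n *\<^sub>R v0"
        by (simp add: f a.add a.scaleR s n_def of_rat_diff of_rat_mult of_rat_minus algebra_simps)
      moreover have "h (?k (f v0)) = ?k v0"
        using commute_E[OF hE k, of "f v0"] commute_E[OF hE fE, of v0] inv by simp
      ultimately have hn: "of_rat n *\<^sub>R h v0 = ?k v0"
        using complex_linear_imp_linear[OF lin[OF hE]] by (metis linear_scale)
      \<comment> \<open>If \<open>n = 0\<close>, the conjugate vanishes at \<open>v0\<close>. Then
        \<open>q = 0\<close> would give \<open>f v0 = 0\<close>, impossible for an invertible
        \<open>f\<close>, while \<open>q \<noteq> 0\<close> would make \<open>a v0\<close> a
        rational multiple of \<open>v0\<close>.\<close>
      have "n \<noteq> 0"
      proof
        assume "n = 0"
        then have pq: "of_rat p *\<^sub>R v0 = of_rat q *\<^sub>R a v0" using hn by (simp add: of_rat_minus)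
        have "q \<noteq> 0"
        proof
          assume "q = 0"
          with pq v0_nonzero have "p = 0" by simp
          with \<open>q = 0\<close> f have "f v0 = 0" by simp
          then have "h (f v0) = 0" using complex_linear_imp_linear[OF lin[OF hE]] linear_0 by metis
          then show False using commute_E[OF hE fE, of v0] inv v0_nonzero by simp
        qed
        have "of_rat (inverse q) *\<^sub>R (of_rat p *\<^sub>R v0) = a v0" using pq \<open>q \<noteq> 0\<close>
          by (simp add: of_rat_inverse)
        then have "a v0 = of_rat (inverse q * p) *\<^sub>R v0" by (simp add: of_rat_mult)
        then show False using a(2) by (simp add: rat_vs.span_scale rat_vs.span_base)
      qed
      then have "h v0 = of_rat (inverse n) *\<^sub>R (of_rat n *\<^sub>R h v0)" by (simp add: of_rat_inverse)
      also have "\<dots> = of_rat (inverse n * p) *\<^sub>R v0 + of_rat (inverse n * - q) *\<^sub>R a v0"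
        by (simp add: hn of_rat_mult scaleR_diff_right)
      finally show "h \<in> K" by (rule Kmem[OF hE])
    qed (auto simp: K_def id_E scale_E rat_vs.span_scale rat_vs.span_base)
    moreover have "a \<in> K" using a by (simp add: K_def rat_vs.span_base)
    moreover have "a \<notin> range (\<lambda>q x. of_rat q *\<^sub>R x)"
      using a(2) by (auto simp: rat_vs.span_scale rat_vs.span_base)
    ultimately have "K = E" by blast
    \<comment> \<open>Now \<open>W\<close> is spanned by two vectors, whereas \<open>B\<close> is
      independent over the rationals and has more than two elements.\<close>
    then have "W \<subseteq> rat_vs.span {v0, a v0}" using orbit_ex unfolding W_def K_def by force
    then have "B \<subseteq> rat_vs.span {v0, a v0}" using rat_vs.span_superset W_def by blast
    then have "card B \<le> card {v0, a v0}"
      using rat_vs.independent_span_bound[of "{v0, a v0}" B] real_independent_imp_rat_independent[OF independent_B]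
      by blast
    also have "\<dots> \<le> 2" using card_insert_le_m1[of 2 "{a v0}" v0] by simp
    finally show ?thesis using card_B by simp
  qed
qed

end

section \<open>Lifting homomorphisms of tori\<close>

text \<open>Separation is required only at 0; translation by group elements gives the same radius at
  every other point of the group.\<close>

definition discrete_subgroup :: "'v::real_normed_vector set \<Rightarrow> bool" where
  "discrete_subgroup \<Gamma> \<longleftrightarrow> 0 \<in> \<Gamma> \<and> (\<forall>x\<in>\<Gamma>. \<forall>y\<in>\<Gamma>. x - y \<in> \<Gamma>) \<and>
     (\<exists>e>0. \<forall>x\<in>\<Gamma>. norm x < e \<longrightarrow> x = 0)"

lemma discrete_subgroupD:
  assumes "discrete_subgroup \<Gamma>"
  shows "0 \<in> \<Gamma>" "x \<in> \<Gamma> \<Longrightarrow> y \<in> \<Gamma> \<Longrightarrow> x - y \<in> \<Gamma>" "x \<in> \<Gamma> \<Longrightarrow> - x \<in> \<Gamma>"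
    "x \<in> \<Gamma> \<Longrightarrow> y \<in> \<Gamma> \<Longrightarrow> x + y \<in> \<Gamma>"
proof -
  show 0: "0 \<in> \<Gamma>" and d: "\<And>x y. x \<in> \<Gamma> \<Longrightarrow> y \<in> \<Gamma> \<Longrightarrow> x - y \<in> \<Gamma>"
    using assms by (auto simp: discrete_subgroup_def)
  show m: "- x \<in> \<Gamma>" if "x \<in> \<Gamma>" for x using d[OF 0 that] by simp
  show "x \<in> \<Gamma> \<Longrightarrow> y \<in> \<Gamma> \<Longrightarrow> x + y \<in> \<Gamma>" using d[of x "- y"] m[of y] by simp
qed

section \<open>The quotient of a vector space by a discrete subgroup\<close>

lemma comm_group_vector_group: "comm_group (vector_group :: 'v::complex_normed_vector monoid)"
proof (rule comm_groupI)
  fix x :: 'v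
  show "\<exists>y\<in>carrier vector_group. y \<otimes>\<^bsub>vector_group\<^esub> x = \<one>\<^bsub>vector_group\<^esub>"
    by (rule bexI[of _ "- x"]) (simp_all add: vector_group_def)
qed (simp_all add: vector_group_def)

lemma inv_vector_group: "inv\<^bsub>vector_group\<^esub> x = - (x::'v::complex_normed_vector)"
  by (rule group.inv_equality[OF comm_group.axioms(2)[OF comm_group_vector_group]])
     (simp_all add: vector_group_def)

lemma normal_vector_group:
  assumes "discrete_subgroup (\<Gamma>::'v::complex_normed_vector set)"
  shows "\<Gamma> \<lhd> vector_group"
proof (rule comm_group.normal_iff_subgroup[OF comm_group_vector_group, THEN iffD2])
  show "subgroup \<Gamma> vector_group"
    by (rule subgroup.intro)
       (simp_all add: inv_vector_group discrete_subgroupD[OF assms], simp_all add: vector_group_def discrete_subgroupD[OF assms])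
qed

lemma torus_proj_eq_image: "torus_proj \<Gamma> v = (\<lambda>x. x + v) ` \<Gamma>"
  by (auto simp: torus_proj_def r_coset_def vector_group_def)

lemma torus_proj_eq_iff:
  assumes "discrete_subgroup \<Gamma>"
  shows "torus_proj \<Gamma> u = torus_proj \<Gamma> v \<longleftrightarrow> u - v \<in> \<Gamma>"
proof
  assume "torus_proj \<Gamma> u = torus_proj \<Gamma> v"
  moreover have "u \<in> torus_proj \<Gamma> u"
    using discrete_subgroupD(1)[OF assms] by (force simp: torus_proj_eq_image)
  ultimately show "u - v \<in> \<Gamma>" by (auto simp: torus_proj_eq_image)
next
  assume uv: "u - v \<in> \<Gamma>"
  have "x + u \<in> torus_proj \<Gamma> v" if "x \<in> \<Gamma>" for x
    using discrete_subgroupD(4)[OF assms that uv]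
    by (auto simp: torus_proj_eq_image intro!: image_eqI[of _ _ "x + (u - v)"])
  moreover have "x + v \<in> torus_proj \<Gamma> u" if "x \<in> \<Gamma>" for x
    using discrete_subgroupD(2)[OF assms that uv]
    by (auto simp: torus_proj_eq_image intro!: image_eqI[of _ _ "x - (u - v)"])
  ultimately show "torus_proj \<Gamma> u = torus_proj \<Gamma> v" by (auto simp: torus_proj_eq_image)
qed

lemma torus_carrier: "carrier (torus \<Gamma>) = range (torus_proj \<Gamma>)"
  by (simp add: torus_def carrier_FactGroup torus_proj_def[abs_def] vector_group_def)

lemma torus_mult:
  assumes "discrete_subgroup \<Gamma>"
  shows "torus_proj \<Gamma> u \<otimes>\<^bsub>torus \<Gamma>\<^esub> torus_proj \<Gamma> v = torus_proj \<Gamma> (u + v)"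
  using normal.rcos_sum[OF normal_vector_group[OF assms], of u v]
  by (simp add: torus_def torus_proj_def vector_group_def)

lemma torus_one: "\<one>\<^bsub>torus \<Gamma>\<^esub> = torus_proj \<Gamma> 0"
  by (simp add: torus_def torus_proj_eq_image)

lemma torus_proj_self: "torus_proj \<Gamma> v \<in> carrier (torus \<Gamma>)"
  by (simp add: torus_carrier)

lemma group_torus:
  assumes "discrete_subgroup \<Gamma>"
  shows "group (torus \<Gamma>)"
  unfolding torus_def by (rule normal.factorgroup_is_group[OF normal_vector_group[OF assms]])

text \<open>\<open>L\<close> is the analytic representation of \<open>f\<close>. Boundedness is
  demanded explicitly because the covering spaces are not assumed finite-dimensional here.\<close>

definition torus_lift ::
  "'v::complex_normed_vector set \<Rightarrow> 'w::complex_normed_vector set \<Rightarrow> ('v set \<Rightarrow> 'w set) \<Rightarrow> ('v \<Rightarrow> 'w) \<Rightarrow> bool" where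
  "torus_lift \<Gamma> \<Gamma>' f L \<longleftrightarrow>
     bounded_linear L \<and> complex_linear L \<and> (\<forall>v. f (torus_proj \<Gamma> v) = torus_proj \<Gamma>' (L v))"

lemma half_power_small:
  fixes v :: "'v::real_normed_vector" assumes "0 < e"
  obtains n where "norm ((1 / 2 ^ n) *\<^sub>R v) < e"
proof -
  have "(\<lambda>n. norm v * (1 / 2) ^ n) \<longlonglongrightarrow> norm v * 0"
    by (intro tendsto_mult tendsto_const LIMSEQ_realpow_zero) auto
  then have "\<forall>\<^sub>F n in sequentially. norm v * (1 / 2) ^ n < e"
    using assms by (intro order_tendstoD) auto
  then obtain n where "norm v * (1 / 2) ^ n < e" by (auto simp: eventually_sequentially)
  then have "norm ((1 / 2 ^ n) *\<^sub>R v) < e" by (simp add: power_one_over field_simps)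
  then show thesis by (rule that)
qed

text \<open>Repeated halving gives \<open>G u = 2 ^ n *\<^sub>R G ((1 / 2 ^ n) *\<^sub>R u)\<close>.
  For suitable \<open>n\<close> the first-order error at the small vector is at most
  \<open>e\<close> times its norm, so scaling back leaves the bound \<open>e * norm u\<close> with
  \<open>e\<close> arbitrary.\<close>

lemma locally_additive_eq_derivative:
  fixes G :: "'v::real_normed_vector \<Rightarrow> 'w::real_normed_vector"
  assumes deriv: "(G has_derivative D) (at 0)" and G0: "G 0 = 0"
    and double: "\<And>u. norm u < d \<Longrightarrow> G u = 2 *\<^sub>R G ((1/2) *\<^sub>R u)"
    and u: "norm u < d"
  shows "G u = D u"
proof -
  interpret D: bounded_linear D using deriv by (rule has_derivative_bounded_linear)
  have pow: "G u = 2 ^ n *\<^sub>R G ((1 / 2 ^ n) *\<^sub>R u)" for n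
  proof (induction n)
    case (Suc n)
    have "norm ((1 / 2 ^ n) *\<^sub>R u) \<le> norm u"
      using mult_left_mono[of 1 "2 ^ n" "norm u"] by (simp add: field_simps)
    then have "G ((1 / 2 ^ n) *\<^sub>R u) = 2 *\<^sub>R G ((1 / 2) *\<^sub>R (1 / 2 ^ n) *\<^sub>R u)"
      using double u by force
    then show ?case using Suc by (simp add: mult.commute)
  qed simp
  have small: "norm (G u - D u) \<le> e * norm u" if e: "e > 0" for e
  proof -
    from deriv[unfolded has_derivative_at_alt] e obtain k where k: "k > 0"
      "\<And>y. norm (y - 0) < k \<Longrightarrow> norm (G y - G 0 - D (y - 0)) \<le> e * norm (y - 0)" by metis
    obtain n where n: "norm ((1 / 2 ^ n) *\<^sub>R u) < k" using half_power_small[OF k(1)] by blast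
    let ?y = "(1 / 2 ^ n) *\<^sub>R u"
    have "G u - D u = 2 ^ n *\<^sub>R (G ?y - D ?y)"
      unfolding scaleR_diff_right pow[of n, symmetric] D.scaleR[symmetric] by simp
    then have "norm (G u - D u) = 2 ^ n * norm (G ?y - D ?y)" by simp
    also have "\<dots> \<le> 2 ^ n * (e * norm ?y)" using k(2)[of ?y] n G0 by (intro mult_left_mono) auto
    finally show ?thesis by simp
  qed
  have "norm (G u - D u) \<le> 0"
  proof (rule field_le_epsilon)
    fix e :: real assume "e > 0"
    \<comment> \<open>The summand 1 keeps the divisor positive when \<open>u = 0\<close>.\<close>
    then have "norm (G u - D u) \<le> e / (norm u + 1) * norm u"
      by (intro small divide_pos_pos) (simp_all add: add_nonneg_pos)
    also have "\<dots> \<le> e" using \<open>e > 0\<close>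
      by (simp add: pos_divide_le_eq add_nonneg_pos distrib_left)
    finally show "norm (G u - D u) \<le> 0 + e" by simp
  qed
  then show ?thesis by simp
qed

text \<open>The lift is the derivative at 0 of a local holomorphic representative. Near 0 the
  homomorphism law gives the doubling identity up to an element of \<open>\<Gamma>'\<close> that is
  too short to be nonzero. Halving brings any vector close to 0, and the homomorphism law carries
  the formula back.\<close>

lemma torus_Hom_imp_lift:
  fixes \<Gamma> :: "'v::complex_normed_vector set" and \<Gamma>' :: "'w::complex_normed_vector set"
  assumes \<Gamma>: "discrete_subgroup \<Gamma>" and \<Gamma>': "discrete_subgroup \<Gamma>'" and f: "f \<in> torus_Hom \<Gamma> \<Gamma>'"
  shows "\<exists>L. torus_lift \<Gamma> \<Gamma>' f L"
proof -
  have hom: "f \<in> hom (torus \<Gamma>) (torus \<Gamma>')" using f by (simp add: torus_Hom_def)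
  have f0: "f (torus_proj \<Gamma> 0) = torus_proj \<Gamma>' 0"
    using hom_one[OF hom group_torus[OF \<Gamma>] group_torus[OF \<Gamma>']] by (simp add: torus_one)
  have fadd: "f (torus_proj \<Gamma> (u + v)) = f (torus_proj \<Gamma> u) \<otimes>\<^bsub>torus \<Gamma>'\<^esub> f (torus_proj \<Gamma> v)" for u v
    using hom_mult[OF hom torus_proj_self torus_proj_self] by (simp add: torus_mult[OF \<Gamma>])
  obtain U F where U: "open U" "0 \<in> U" and F: "complex_differentiable_on F U"
    and fF: "\<And>u. u \<in> U \<Longrightarrow> f (torus_proj \<Gamma> u) = torus_proj \<Gamma>' (F u)"
    using f unfolding torus_Hom_def torus_holomorphic_def by blast
  define G where "G u = F u - F 0" for u
  have F0: "F 0 \<in> \<Gamma>'" using fF[OF U(2)] f0 torus_proj_eq_iff[OF \<Gamma>', of "F 0" 0] by simp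
  have fG: "f (torus_proj \<Gamma> u) = torus_proj \<Gamma>' (G u)" if "u \<in> U" for u
    using fF[OF that] F0 by (simp add: torus_proj_eq_iff[OF \<Gamma>'] G_def)
  from F U obtain D where FD: "(F has_derivative D) (at 0)" and DC: "\<And>c v. D (c *\<^sub>C v) = c *\<^sub>C D v"
    unfolding complex_differentiable_on_def by blast
  have GD: "(G has_derivative D) (at 0)" unfolding G_def[abs_def] by (auto intro!: derivative_eq_intros FD)
  obtain e where e: "e > 0" "\<And>x. x \<in> \<Gamma>' \<Longrightarrow> norm x < e \<Longrightarrow> x = 0"
    using \<Gamma>' by (auto simp: discrete_subgroup_def)
  have "isCont G 0" using GD by (rule has_derivative_continuous)
  \<comment> \<open>The doubling defect is a sum of three values of \<open>G\<close>, so the bound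
    \<open>e / 4\<close> on each makes it shorter than \<open>e\<close>.\<close>
  then obtain d1 where d1: "d1 > 0" "\<And>u. norm u < d1 \<Longrightarrow> norm (G u) < e / 4"
    unfolding continuous_at_eps_delta using e(1)
    by (metis G_def cancel_comm_monoid_add_class.diff_cancel diff_zero dist_norm divide_pos_pos zero_less_numeral)
  obtain d2 where d2: "d2 > 0" "\<And>u. norm u < d2 \<Longrightarrow> u \<in> U"
    using openE[OF U] by (metis dist_norm diff_zero dist_commute mem_ball subset_iff)
  define d where "d = min d1 d2"
  have d: "d > 0" using d1 d2 by (simp add: d_def)
  have "G u = 2 *\<^sub>R G ((1/2) *\<^sub>R u)" if u: "norm u < d" for u
  proof -
    let ?w = "(1/2) *\<^sub>R u"
    have w: "norm ?w < d" using u norm_ge_zero[of u] by (simp; linarith)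
    have "torus_proj \<Gamma>' (G u) = f (torus_proj \<Gamma> (?w + ?w))"
      using fG d2 u by (simp add: d_def flip: scaleR_add_left)
    also have "\<dots> = torus_proj \<Gamma>' (G ?w + G ?w)"
      unfolding fadd using fG[of ?w] d2(2)[of ?w] w by (simp add: d_def torus_mult[OF \<Gamma>'])
    finally have "G u - (G ?w + G ?w) \<in> \<Gamma>'" by (simp add: torus_proj_eq_iff[OF \<Gamma>'])
    moreover have "norm (G u - (G ?w + G ?w)) < e"
    proof -
      have "norm (G u - (G ?w + G ?w)) \<le> norm (G u) + (norm (G ?w) + norm (G ?w))"
        by (meson norm_triangle_ineq norm_triangle_ineq4 order_trans add_left_mono)
      moreover have "norm (G u) < e / 4" "norm (G ?w) < e / 4"
        using d1(2)[of u] d1(2)[of ?w] u w by (auto simp: d_def)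
      ultimately show ?thesis using e(1) by linarith
    qed
    ultimately have "G u - (G ?w + G ?w) = 0" using e(2) by blast
    then show ?thesis by (simp add: scaleR_2)
  qed
  then have GL: "G u = D u" if "norm u < d" for u
    using locally_additive_eq_derivative[OF GD _ _ that] by (simp add: G_def)
  interpret D: bounded_linear D using FD by (rule has_derivative_bounded_linear)
  have "f (torus_proj \<Gamma> v) = torus_proj \<Gamma>' (D v)" for v
  proof -
    obtain n where n: "norm ((1 / 2 ^ n) *\<^sub>R v) < d" using half_power_small[OF d] by blast
    let ?y = "(1 / 2 ^ n) *\<^sub>R v"
    \<comment> \<open>The induction climbs by doubling from the small vector \<open>?y\<close>,
      where \<open>G\<close> and \<open>D\<close> agree, and reaches \<open>v\<close> at
      \<open>k = n\<close>.\<close>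
    have "f (torus_proj \<Gamma> (2 ^ k *\<^sub>R ?y)) = torus_proj \<Gamma>' (D (2 ^ k *\<^sub>R ?y))" for k
    proof (induction k)
      case 0
      have "?y \<in> U" using n d2 by (simp add: d_def)
      then show ?case using fG[of ?y] GL[OF n] by simp
    next
      case (Suc k)
      have "2 ^ Suc k *\<^sub>R ?y = 2 ^ k *\<^sub>R ?y + 2 ^ k *\<^sub>R ?y" by (simp flip: scaleR_add_left)
      then show ?case by (simp only: fadd Suc torus_mult[OF \<Gamma>'] D.add)
    qed
    from this[of n] show ?thesis by simp
  qed
  then have "torus_lift \<Gamma> \<Gamma>' f D"
    using D.bounded_linear_axioms D.add DC by (simp add: torus_lift_def complex_linear_def)
  then show ?thesis by blast
qed

lemma torus_lift_imp_Hom: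
  assumes \<Gamma>: "discrete_subgroup \<Gamma>" and \<Gamma>': "discrete_subgroup \<Gamma>'"
    and L: "torus_lift \<Gamma> \<Gamma>' f L" and ext: "f \<in> extensional (carrier (torus \<Gamma>))"
  shows "f \<in> torus_Hom \<Gamma> \<Gamma>'"
proof -
  have bl: "bounded_linear L" and c: "complex_linear L"
    and f: "\<And>v. f (torus_proj \<Gamma> v) = torus_proj \<Gamma>' (L v)"
    using L by (auto simp: torus_lift_def)
  have "f \<in> hom (torus \<Gamma>) (torus \<Gamma>')"
    using c by (auto simp: hom_def torus_carrier f torus_mult[OF \<Gamma>] torus_mult[OF \<Gamma>'] complex_linear_def)
  moreover have "torus_holomorphic \<Gamma> \<Gamma>' f"
    unfolding torus_holomorphic_def complex_differentiable_on_def
    using bounded_linear_imp_has_derivative[OF bl] c f by (metis UNIV_I complex_linear_def open_UNIV)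
  ultimately show ?thesis using ext by (simp add: torus_Hom_def)
qed

text \<open>The difference of two lifts is linear with values in \<open>\<Gamma>'\<close>. Scaling
  \<open>v\<close> down makes the value shorter than the separation radius, so it vanishes.\<close>

lemma torus_lift_unique:
  assumes \<Gamma>': "discrete_subgroup \<Gamma>'" and L: "torus_lift \<Gamma> \<Gamma>' f L" and M: "torus_lift \<Gamma> \<Gamma>' f M"
  shows "L = M"
proof
  fix v
  obtain e where e: "e > 0" "\<And>x. x \<in> \<Gamma>' \<Longrightarrow> norm x < e \<Longrightarrow> x = 0"
    using \<Gamma>' by (auto simp: discrete_subgroup_def)
  interpret L: bounded_linear L using L by (simp add: torus_lift_def)
  interpret M: bounded_linear M using M by (simp add: torus_lift_def)
  have mem: "L u - M u \<in> \<Gamma>'" for u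
    using L M by (simp add: torus_lift_def flip: torus_proj_eq_iff[OF \<Gamma>'])
  obtain n where n: "norm ((1 / 2 ^ n) *\<^sub>R (L v - M v)) < e" using half_power_small[OF e(1)] by blast
  have "(1 / 2 ^ n) *\<^sub>R (L v - M v) = L ((1 / 2 ^ n) *\<^sub>R v) - M ((1 / 2 ^ n) *\<^sub>R v)"
    by (simp only: L.scaleR M.scaleR scaleR_diff_right)
  then have "(1 / 2 ^ n) *\<^sub>R (L v - M v) = 0" using e(2) mem n by metis
  then show "L v = M v" by simp
qed

lemma torus_lift_mem:
  assumes \<Gamma>: "discrete_subgroup \<Gamma>" and \<Gamma>': "discrete_subgroup \<Gamma>'" and L: "torus_lift \<Gamma> \<Gamma>' f L"
    and v: "v \<in> \<Gamma>"
  shows "L v \<in> \<Gamma>'"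
proof -
  have "torus_proj \<Gamma> v = torus_proj \<Gamma> 0" using v by (simp add: torus_proj_eq_iff[OF \<Gamma>])
  then have "torus_proj \<Gamma>' (L v) = torus_proj \<Gamma>' (L 0)" using L by (metis torus_lift_def)
  moreover have "L 0 = 0" using L by (simp add: torus_lift_def linear_simps)
  ultimately show ?thesis by (simp add: torus_proj_eq_iff[OF \<Gamma>'])
qed

section \<open>Lifts of the ring operations\<close>

lemma torus_zero_hom_lift: "torus_lift \<Gamma> \<Gamma>' (torus_zero_hom \<Gamma> \<Gamma>') (\<lambda>v. 0)"
  by (simp add: torus_lift_def torus_zero_hom_def torus_proj_self torus_one complex_linear_zero)

lemma torus_id_lift: "torus_lift \<Gamma> \<Gamma> (\<lambda>x\<in>carrier (torus \<Gamma>). x) (\<lambda>v. v)"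
  by (simp add: torus_lift_def torus_proj_self complex_linear_id bounded_linear_ident)

lemma torus_compose_lift:
  assumes "torus_lift \<Gamma> \<Gamma> f L" "torus_lift \<Gamma> \<Gamma> h M"
  shows "torus_lift \<Gamma> \<Gamma> (compose (carrier (torus \<Gamma>)) f h) (\<lambda>v. L (M v))"
  using assms by (simp add: torus_lift_def torus_proj_self compose_def complex_linear_compose bounded_linear_compose)

lemma torus_add_lift:
  assumes "discrete_subgroup \<Gamma>" "torus_lift \<Gamma> \<Gamma> f L" "torus_lift \<Gamma> \<Gamma> h M"
  shows "torus_lift \<Gamma> \<Gamma> (\<lambda>x\<in>carrier (torus \<Gamma>). f x \<otimes>\<^bsub>torus \<Gamma>\<^esub> h x) (\<lambda>v. L v + M v)"
  using assms by (simp add: torus_lift_def torus_proj_self torus_mult complex_linear_add bounded_linear_add)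

lemma torus_Hom_eqI:
  assumes "f \<in> torus_Hom \<Gamma> \<Gamma>'" "h \<in> torus_Hom \<Gamma> \<Gamma>'" "torus_lift \<Gamma> \<Gamma>' f L" "torus_lift \<Gamma> \<Gamma>' h L"
  shows "f = h"
proof (rule extensionalityI)
  show "f \<in> extensional (carrier (torus \<Gamma>))" "h \<in> extensional (carrier (torus \<Gamma>))"
    using assms by (auto simp: torus_Hom_def)
  show "f x = h x" if "x \<in> carrier (torus \<Gamma>)" for x
    using that assms by (auto simp: torus_carrier torus_lift_def)
qed

text \<open>The monoid laws make the free ring on pairs a ring; closure under addition keeps the
  biadditivity relations inside its carrier.\<close>

lemma torus_End_monoid:
  assumes \<Gamma>: "discrete_subgroup \<Gamma>"
  shows "monoid (torus_End \<Gamma>)"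
    and "\<And>f h. f \<in> carrier (torus_End \<Gamma>) \<Longrightarrow> h \<in> carrier (torus_End \<Gamma>) \<Longrightarrow>
      f \<oplus>\<^bsub>torus_End \<Gamma>\<^esub> h \<in> carrier (torus_End \<Gamma>)"
proof -
  have lift: "\<exists>L. torus_lift \<Gamma> \<Gamma> f L" if "f \<in> torus_Hom \<Gamma> \<Gamma>" for f
    using torus_Hom_imp_lift[OF \<Gamma> \<Gamma> that] .
  have maps: "f x \<in> carrier (torus \<Gamma>)" if "f \<in> torus_Hom \<Gamma> \<Gamma>" "x \<in> carrier (torus \<Gamma>)" for f x
    using that by (auto simp: torus_Hom_def hom_def)
  have ext: "f \<in> extensional (carrier (torus \<Gamma>))" if "f \<in> torus_Hom \<Gamma> \<Gamma>" for f
    using that by (auto simp: torus_Hom_def)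
  have comp: "compose (carrier (torus \<Gamma>)) f h \<in> torus_Hom \<Gamma> \<Gamma>"
    if "f \<in> torus_Hom \<Gamma> \<Gamma>" "h \<in> torus_Hom \<Gamma> \<Gamma>" for f h
    using lift[OF that(1)] lift[OF that(2)] torus_compose_lift torus_lift_imp_Hom[OF \<Gamma> \<Gamma>] compose_extensional
    by metis
  have id: "(\<lambda>x\<in>carrier (torus \<Gamma>). x) \<in> torus_Hom \<Gamma> \<Gamma>"
    by (rule torus_lift_imp_Hom[OF \<Gamma> \<Gamma> torus_id_lift]) simp
  show "monoid (torus_End \<Gamma>)"
  proof (rule monoidI)
    fix f h k assume "f \<in> carrier (torus_End \<Gamma>)" "h \<in> carrier (torus_End \<Gamma>)" "k \<in> carrier (torus_End \<Gamma>)"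
    then show "f \<otimes>\<^bsub>torus_End \<Gamma>\<^esub> h \<otimes>\<^bsub>torus_End \<Gamma>\<^esub> k = f \<otimes>\<^bsub>torus_End \<Gamma>\<^esub> (h \<otimes>\<^bsub>torus_End \<Gamma>\<^esub> k)"
      using maps by (simp add: torus_End_def compose_def fun_eq_iff)
  next
    fix f assume f: "f \<in> carrier (torus_End \<Gamma>)"
    then have fH: "f \<in> torus_Hom \<Gamma> \<Gamma>" by (simp add: torus_End_def)
    show "\<one>\<^bsub>torus_End \<Gamma>\<^esub> \<otimes>\<^bsub>torus_End \<Gamma>\<^esub> f = f"
      using maps[OF fH] ext[OF fH] by (auto simp: torus_End_def compose_def fun_eq_iff extensional_def)
    show "f \<otimes>\<^bsub>torus_End \<Gamma>\<^esub> \<one>\<^bsub>torus_End \<Gamma>\<^esub> = f"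
      using ext[OF fH] by (auto simp: torus_End_def compose_def fun_eq_iff extensional_def)
  qed (simp_all add: torus_End_def comp id)
  fix f h assume "f \<in> carrier (torus_End \<Gamma>)" "h \<in> carrier (torus_End \<Gamma>)"
  then obtain L M where "torus_lift \<Gamma> \<Gamma> f L" "torus_lift \<Gamma> \<Gamma> h M"
    using lift[of f] lift[of h] by (auto simp: torus_End_def)
  then show "f \<oplus>\<^bsub>torus_End \<Gamma>\<^esub> h \<in> carrier (torus_End \<Gamma>)"
    using torus_lift_imp_Hom[OF \<Gamma> \<Gamma> torus_add_lift[OF \<Gamma>]] by (simp add: torus_End_def)
qed

section \<open>The free ring on pairs\<close>

definition frag_eval :: "('p \<Rightarrow> 'a::real_vector) \<Rightarrow> ('p \<Rightarrow>\<^sub>0 int) \<Rightarrow> 'a" where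
  "frag_eval h c = (\<Sum>p\<in>Poly_Mapping.keys c. of_int (Poly_Mapping.lookup c p) *\<^sub>R h p)"

lemma frag_eval_superset:
  assumes "finite S" "Poly_Mapping.keys c \<subseteq> S"
  shows "frag_eval h c = (\<Sum>p\<in>S. of_int (Poly_Mapping.lookup c p) *\<^sub>R h p)"
  unfolding frag_eval_def using assms
  by (intro sum.mono_neutral_left) (auto simp: in_keys_iff)

lemma frag_eval_zero [simp]: "frag_eval h 0 = 0"
  and frag_eval_of [simp]: "frag_eval h (frag_of p) = h p"
  by (simp_all add: frag_eval_def)

lemma frag_eval_diff: "frag_eval h (c - d) = frag_eval h c - frag_eval h d"
  and frag_eval_add: "frag_eval h (c + d) = frag_eval h c + frag_eval h d"
proof -
  let ?S = "Poly_Mapping.keys c \<union> Poly_Mapping.keys d"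
  have S: "finite ?S" "Poly_Mapping.keys c \<subseteq> ?S" "Poly_Mapping.keys d \<subseteq> ?S" by auto
  note sup = frag_eval_superset[OF S(1) S(2)] frag_eval_superset[OF S(1) S(3)]
  show "frag_eval h (c - d) = frag_eval h c - frag_eval h d"
    unfolding sup frag_eval_superset[OF S(1) keys_diff]
    by (simp add: lookup_minus scaleR_diff_left sum_subtractf)
  show "frag_eval h (c + d) = frag_eval h c + frag_eval h d"
    unfolding sup frag_eval_superset[OF S(1) Poly_Mapping.keys_add]
    by (simp add: lookup_add scaleR_add_left sum.distrib)
qed

lemma frag_extend_fun_diff: "frag_extend (\<lambda>p. f p - h p) c = frag_extend f c - frag_extend h c"
  using subset_UNIV by (induction c rule: frag_induction) (simp_all add: frag_extend_diff)

text \<open>A separate name for the product allows its bilinearity to be used for rewriting without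
  carrier conditions.\<close>

definition frag_mult ::
  "('a, 'm) ring_scheme \<Rightarrow> ('b, 'n) ring_scheme \<Rightarrow> (('a \<times> 'b) \<Rightarrow>\<^sub>0 int) \<Rightarrow> (('a \<times> 'b) \<Rightarrow>\<^sub>0 int) \<Rightarrow> ('a \<times> 'b) \<Rightarrow>\<^sub>0 int" where
  "frag_mult A B c d = c \<otimes>\<^bsub>free_pair_ring A B\<^esub> d"

lemma free_pair_ring_simps:
  "carrier (free_pair_ring A B) = {c. Poly_Mapping.keys c \<subseteq> carrier A \<times> carrier B}"
  "c \<otimes>\<^bsub>free_pair_ring A B\<^esub> d = frag_mult A B c d"
  "\<one>\<^bsub>free_pair_ring A B\<^esub> = frag_of (\<one>\<^bsub>A\<^esub>, \<one>\<^bsub>B\<^esub>)"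
  "\<zero>\<^bsub>free_pair_ring A B\<^esub> = 0"
  "c \<oplus>\<^bsub>free_pair_ring A B\<^esub> d = c + d"
  by (simp_all add: free_pair_ring_def frag_mult_def)

lemma frag_mult_simps:
  "frag_mult A B 0 d = 0" "frag_mult A B c 0 = 0"
  "frag_mult A B (frag_of (a, b)) (frag_of (a', b')) = frag_of (a \<otimes>\<^bsub>A\<^esub> a', b \<otimes>\<^bsub>B\<^esub> b')"
  "frag_mult A B (c - c') d = frag_mult A B c d - frag_mult A B c' d"
  "frag_mult A B c (d - d') = frag_mult A B c d - frag_mult A B c d'"
  by (simp_all add: frag_mult_def free_pair_ring_def frag_extend_diff case_prod_unfold
      frag_extend_fun_diff frag_extend_eq_0)

lemma frag_mult_add:
  "frag_mult A B (c + c') d = frag_mult A B c d + frag_mult A B c' d"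
  "frag_mult A B c (d + d') = frag_mult A B c d + frag_mult A B c d'"
proof -
  show "frag_mult A B (c + c') d = frag_mult A B c d + frag_mult A B c' d"
    using frag_mult_simps(4)[of A B "c + c'" c' d] by simp
  show "frag_mult A B c (d + d') = frag_mult A B c d + frag_mult A B c d'"
    using frag_mult_simps(5)[of A B c "d + d'" d'] by simp
qed

text \<open>This is the integral monoid ring of the product of the two multiplicative monoids, so
  the monoid laws reduce to generators by induction over formal differences.\<close>

lemma ring_free_pair_ring:
  fixes A :: "('a, 'm) ring_scheme" and B :: "('b, 'n) ring_scheme"
  assumes "monoid A" "monoid B"
  shows "ring (free_pair_ring A B)"
proof -
  interpret A: monoid A by fact
  interpret B: monoid B by fact
  let ?C = "carrier A \<times> carrier B"
  have closed: "Poly_Mapping.keys (frag_mult A B c d) \<subseteq> ?C"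
    if c: "Poly_Mapping.keys c \<subseteq> ?C" and d: "Poly_Mapping.keys d \<subseteq> ?C" for c d
    using c
  proof (induction c rule: frag_induction)
    case (one p)
    then obtain a b where p: "p = (a, b)" "a \<in> carrier A" "b \<in> carrier B" by blast
    show ?case using d
    proof (induction d rule: frag_induction)
      case (diff x y)
      then show ?case using keys_diff by (fastforce simp: frag_mult_simps)
    qed (use p in \<open>auto simp: frag_mult_simps\<close>)
  next
    case (diff x y)
    then show ?case using keys_diff by (fastforce simp: frag_mult_simps)
  qed (simp add: frag_mult_simps)
  have assoc: "frag_mult A B (frag_mult A B c d) e = frag_mult A B c (frag_mult A B d e)"
    if c: "Poly_Mapping.keys c \<subseteq> ?C" and d: "Poly_Mapping.keys d \<subseteq> ?C" and e: "Poly_Mapping.keys e \<subseteq> ?C" for c d e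
    using c
  proof (induction c rule: frag_induction)
    case (one p)
    then have p: "p \<in> ?C" .
    show ?case using d
    proof (induction d rule: frag_induction)
      case (one p')
      then have p': "p' \<in> ?C" .
      show ?case using e
        by (induction e rule: frag_induction) (use p p' in \<open>auto simp: frag_mult_simps A.m_assoc B.m_assoc\<close>)
    qed (simp_all add: frag_mult_simps)
  qed (simp_all add: frag_mult_simps)
  have unit: "frag_mult A B (frag_of (\<one>\<^bsub>A\<^esub>, \<one>\<^bsub>B\<^esub>)) c = c" "frag_mult A B c (frag_of (\<one>\<^bsub>A\<^esub>, \<one>\<^bsub>B\<^esub>)) = c"
    if "Poly_Mapping.keys c \<subseteq> ?C" for c
    using that by (induction c rule: frag_induction) (auto simp: frag_mult_simps)
  show ?thesis
  proof (rule ringI)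
    show "abelian_group (free_pair_ring A B)"
    proof (rule abelian_groupI)
      fix c assume "c \<in> carrier (free_pair_ring A B)"
      then show "\<exists>d\<in>carrier (free_pair_ring A B). d \<oplus>\<^bsub>free_pair_ring A B\<^esub> c = \<zero>\<^bsub>free_pair_ring A B\<^esub>"
        by (intro bexI[of _ "- c"]) (simp_all add: free_pair_ring_simps)
    qed (use Poly_Mapping.keys_add in \<open>fastforce simp: free_pair_ring_simps\<close>)+
    show "monoid (free_pair_ring A B)"
      by (rule monoidI) (simp_all add: free_pair_ring_simps closed assoc unit)
  qed (simp_all add: free_pair_ring_simps frag_mult_add)
qed

section \<open>The action of the endomorphism algebra\<close>

abbreviation rat_ring :: "rat ring" where "rat_ring \<equiv> ring_of_type_algebra"

lemma rat_ring_simps: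
  "carrier rat_ring = UNIV" "p \<otimes>\<^bsub>rat_ring\<^esub> q = p * q" "p \<oplus>\<^bsub>rat_ring\<^esub> q = p + q" "\<one>\<^bsub>rat_ring\<^esub> = 1"
  by (simp_all add: ring_of_type_algebra_def)

locale complex_torus =
  fixes \<Gamma> :: "'v::complex_normed_vector set"
  assumes \<Gamma>: "discrete_subgroup \<Gamma>"
begin

definition lift_of :: "('v set \<Rightarrow> 'v set) \<Rightarrow> 'v \<Rightarrow> 'v" where
  "lift_of f = (THE L. torus_lift \<Gamma> \<Gamma> f L)"

lemma lift_of_eqI: "torus_lift \<Gamma> \<Gamma> f L \<Longrightarrow> lift_of f = L"
  unfolding lift_of_def using torus_lift_unique[OF \<Gamma>] by blast

lemma carrier_torus_End: "carrier (torus_End \<Gamma>) = torus_Hom \<Gamma> \<Gamma>"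
  by (simp add: torus_End_def)

lemma lift_of: "f \<in> carrier (torus_End \<Gamma>) \<Longrightarrow> torus_lift \<Gamma> \<Gamma> f (lift_of f)"
  using torus_Hom_imp_lift[OF \<Gamma> \<Gamma>] lift_of_eqI by (metis carrier_torus_End)

lemma lift_of_mult:
  assumes "f \<in> carrier (torus_End \<Gamma>)" "h \<in> carrier (torus_End \<Gamma>)"
  shows "lift_of (f \<otimes>\<^bsub>torus_End \<Gamma>\<^esub> h) v = lift_of f (lift_of h v)"
  using lift_of_eqI[OF torus_compose_lift[OF lift_of[OF assms(1)] lift_of[OF assms(2)]]]
  by (simp add: torus_End_def)

lemma lift_of_add:
  assumes "f \<in> carrier (torus_End \<Gamma>)" "h \<in> carrier (torus_End \<Gamma>)"
  shows "lift_of (f \<oplus>\<^bsub>torus_End \<Gamma>\<^esub> h) v = lift_of f v + lift_of h v"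
  using lift_of_eqI[OF torus_add_lift[OF \<Gamma> lift_of[OF assms(1)] lift_of[OF assms(2)]]]
  by (simp add: torus_End_def)

lemma lift_of_one: "lift_of \<one>\<^bsub>torus_End \<Gamma>\<^esub> v = v"
  using lift_of_eqI[OF torus_id_lift] by (simp add: torus_End_def)

lemma lift_of_complex_linear: "f \<in> carrier (torus_End \<Gamma>) \<Longrightarrow> complex_linear (lift_of f)"
  using lift_of by (simp add: torus_lift_def)

text \<open>A lift maps \<open>\<Gamma>\<close> into itself, and the preimage of a rational subspace
  under a linear map is a rational subspace.\<close>

lemma lift_of_rat_span:
  assumes f: "f \<in> carrier (torus_End \<Gamma>)" and x: "x \<in> rat_vs.span \<Gamma>"
  shows "lift_of f x \<in> rat_vs.span \<Gamma>"
proof -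
  interpret linear "lift_of f" using lift_of_complex_linear[OF f] by (rule complex_linear_imp_linear)
  have "rat_vs.subspace {x. lift_of f x \<in> rat_vs.span \<Gamma>}"
    by (auto simp: rat_vs.subspace_def zero add scaleR rat_vs.span_add rat_vs.span_scale rat_vs.span_zero)
  moreover have "\<Gamma> \<subseteq> {x. lift_of f x \<in> rat_vs.span \<Gamma>}"
    using torus_lift_mem[OF \<Gamma> \<Gamma> lift_of[OF f]] by (auto intro: rat_vs.span_base)
  ultimately show ?thesis using x rat_vs.span_minimal by blast
qed

section \<open>Action of formal combinations on the covering space\<close>

abbreviation "pair_ring \<equiv> free_pair_ring (torus_End \<Gamma>) rat_ring"

definition frag_act :: "((('v set \<Rightarrow> 'v set) \<times> rat) \<Rightarrow>\<^sub>0 int) \<Rightarrow> 'v \<Rightarrow> 'v" where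
  "frag_act c v = frag_eval (\<lambda>p. of_rat (snd p) *\<^sub>R lift_of (fst p) v) c"

lemma frag_act_simps:
  "frag_act 0 v = 0" "frag_act (frag_of p) v = of_rat (snd p) *\<^sub>R lift_of (fst p) v"
  "frag_act (c - d) v = frag_act c v - frag_act d v"
  "frag_act (c + d) v = frag_act c v + frag_act d v"
  by (simp_all add: frag_act_def frag_eval_diff frag_eval_add)

lemma ring_pair_ring: "ring pair_ring"
  using ring_free_pair_ring[OF torus_End_monoid(1)[OF \<Gamma>]] ring_from_type_algebra ring.is_monoid by blast

lemma keys_pair_ring: "c \<in> carrier pair_ring \<longleftrightarrow> Poly_Mapping.keys c \<subseteq> carrier (torus_End \<Gamma>) \<times> UNIV"
  by (simp add: free_pair_ring_simps rat_ring_simps)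

lemma frag_act_complex_linear:
  assumes "c \<in> carrier pair_ring" shows "complex_linear (frag_act c)"
  using assms unfolding keys_pair_ring
proof (induction c rule: frag_induction)
  case (one p)
  then show ?case
    unfolding frag_act_simps by (intro complex_linear_scaleR lift_of_complex_linear) auto
next
  case (diff c d)
  then show ?case unfolding frag_act_simps by (intro complex_linear_diff) auto
qed (simp add: frag_act_simps complex_linear_zero)

lemma frag_act_rat_span:
  assumes "c \<in> carrier pair_ring" and x: "x \<in> rat_vs.span \<Gamma>" shows "frag_act c x \<in> rat_vs.span \<Gamma>"
  using assms(1) unfolding keys_pair_ring
  by (induction c rule: frag_induction)
     (auto simp: frag_act_simps rat_vs.span_zero rat_vs.span_diff rat_vs.span_scale lift_of_rat_span x)

text \<open>On generators this is \<open>lift_of_mult\<close> together with pulling a rational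
  scalar through a linear lift; additivity in \<open>c\<close> and \<open>d\<close> extends
  it.\<close>

lemma frag_act_mult:
  assumes c: "c \<in> carrier pair_ring" and d: "d \<in> carrier pair_ring"
  shows "frag_act (c \<otimes>\<^bsub>pair_ring\<^esub> d) v = frag_act c (frag_act d v)"
  unfolding free_pair_ring_simps
  using c unfolding keys_pair_ring
proof (induction c rule: frag_induction)
  case (one p)
  then obtain f q where p: "p = (f, q)" "f \<in> carrier (torus_End \<Gamma>)" by (cases p) auto
  interpret f: linear "lift_of f" using lift_of_complex_linear[OF p(2)] by (rule complex_linear_imp_linear)
  show ?case using d unfolding keys_pair_ring
  proof (induction d rule: frag_induction)
    case (one p')
    then show ?case
      by (cases p') (auto simp: frag_mult_simps frag_act_simps p lift_of_mult f.scaleR rat_ring_simps of_rat_mult)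
  next
    case (diff a b)
    then show ?case by (simp add: frag_mult_simps frag_act_simps p f.diff scaleR_diff_right)
  qed (simp_all add: frag_mult_simps frag_act_simps p f.zero)
qed (simp_all add: frag_mult_simps frag_act_simps)

section \<open>Descent to the tensor product\<close>

definition tens_ideal where "tens_ideal = tensor_ideal (torus_End \<Gamma>) rat_ring"

lemma relations_subset:
  "biadditivity_relations (torus_End \<Gamma>) rat_ring \<subseteq> {c \<in> carrier pair_ring. \<forall>v. frag_act c v = 0}"
proof -
  have keys: "frag_of (a, p) - frag_of (b, q) - frag_of (c, r) \<in> carrier pair_ring"
    if "a \<in> carrier (torus_End \<Gamma>)" "b \<in> carrier (torus_End \<Gamma>)" "c \<in> carrier (torus_End \<Gamma>)" for a b c p q r
    unfolding keys_pair_ring using that keys_diff[of "frag_of (a, p) - frag_of (b, q)" "frag_of (c, r)"]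
      keys_diff[of "frag_of (a, p)" "frag_of (b, q)"] by auto
  note add = torus_End_monoid(2)[OF \<Gamma>]
  show ?thesis
  proof
    fix x assume "x \<in> biadditivity_relations (torus_End \<Gamma>) rat_ring"
    then consider a a' b where "a \<in> carrier (torus_End \<Gamma>)" "a' \<in> carrier (torus_End \<Gamma>)"
        "x = frag_of (a \<oplus>\<^bsub>torus_End \<Gamma>\<^esub> a', b) - frag_of (a, b) - frag_of (a', b)"
      | a b b' where "a \<in> carrier (torus_End \<Gamma>)"
        "x = frag_of (a, b \<oplus>\<^bsub>rat_ring\<^esub> b') - frag_of (a, b) - frag_of (a, b')"
      by (auto simp: biadditivity_relations_def)
    then show "x \<in> {c \<in> carrier pair_ring. \<forall>v. frag_act c v = 0}"
    proof cases
      case 1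
      then show ?thesis using keys[OF add[of a a']] by (simp add: frag_act_simps lift_of_add scaleR_add_right)
    next
      case 2
      then show ?thesis using keys[of a a a]
        by (simp add: frag_act_simps rat_ring_simps of_rat_add scaleR_add_left)
    qed
  qed
qed

lemma ideal_tens_ideal: "ideal tens_ideal pair_ring"
  unfolding tens_ideal_def tensor_ideal_def
  by (rule ring.genideal_ideal[OF ring_pair_ring]) (use relations_subset in blast)

text \<open>The elements acting as zero form a two-sided ideal containing the biadditivity
  relations, hence contain the ideal generated by them. This makes the action well defined on the
  tensor product.\<close>

lemma frag_act_tens_ideal:
  assumes "c \<in> tens_ideal" shows "frag_act c v = 0"
proof -
  interpret ring pair_ring by (rule ring_pair_ring)
  let ?K = "{c \<in> carrier pair_ring. \<forall>v. frag_act c v = 0}"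
  have lin: "linear (frag_act c)" if "c \<in> carrier pair_ring" for c
    using frag_act_complex_linear[OF that] by (rule complex_linear_imp_linear)
  have "ideal ?K pair_ring"
  proof (rule idealI)
    show "ring pair_ring" by (rule ring_pair_ring)
    show "subgroup ?K (add_monoid pair_ring)"
    proof (rule group.subgroupI)
      show "group (add_monoid pair_ring)" by (rule add.is_group)
      show "?K \<noteq> {}" by (force intro: exI[of _ "0"] simp: free_pair_ring_simps frag_act_simps)
      fix c d assume c: "c \<in> ?K" and d: "d \<in> ?K"
      have "\<ominus>\<^bsub>pair_ring\<^esub> c = - c"
        using c by (intro minus_equality) (simp_all add: free_pair_ring_simps)
      moreover have "frag_act (- c) v = - frag_act c v" for v
        using frag_act_simps(3)[of 0 c v] by (simp add: frag_act_simps)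
      moreover have "- c \<in> carrier pair_ring" using c by (simp add: free_pair_ring_simps)
      ultimately show "inv\<^bsub>add_monoid pair_ring\<^esub> c \<in> ?K"
        using c unfolding a_inv_def by simp
      show "c \<otimes>\<^bsub>add_monoid pair_ring\<^esub> d \<in> ?K"
        using c d a_closed[of c d] by (simp add: free_pair_ring_simps(5) frag_act_simps)
    qed auto
    show "x \<otimes>\<^bsub>pair_ring\<^esub> a \<in> ?K" "a \<otimes>\<^bsub>pair_ring\<^esub> x \<in> ?K" if "a \<in> ?K" "x \<in> carrier pair_ring" for a x
      using that frag_act_mult linear_0[OF lin] by simp_all
  qed
  then have "tens_ideal \<subseteq> ?K"
    unfolding tens_ideal_def tensor_ideal_def by (rule genideal_minimal) (rule relations_subset)
  with assms show ?thesis by blast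
qed

lemma torus_End0_eq: "torus_End0 \<Gamma> = pair_ring Quot tens_ideal"
  by (simp add: torus_End0_def tensor_ring_def tens_ideal_def)

definition End0_class where "End0_class = a_r_coset pair_ring tens_ideal"

lemma End0_class_hom: "End0_class \<in> ring_hom pair_ring (torus_End0 \<Gamma>)"
  using ideal.rcos_ring_hom[OF ideal_tens_ideal] by (simp add: torus_End0_eq End0_class_def)

lemma carrier_End0: "carrier (torus_End0 \<Gamma>) = End0_class ` carrier pair_ring"
  by (auto simp: torus_End0_eq End0_class_def FactRing_def A_RCOSETS_def RCOSETS_def a_r_coset_def)

definition End0_act :: "((('v set \<Rightarrow> 'v set) \<times> rat) \<Rightarrow>\<^sub>0 int) set \<Rightarrow> 'v \<Rightarrow> 'v" where
  "End0_act \<xi> = frag_act (inv_into (carrier pair_ring) End0_class \<xi>)"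

text \<open>The representative chosen in \<open>End0_act\<close> differs from \<open>c\<close> by an
  element of the ideal, which acts as zero.\<close>

lemma End0_act_class:
  assumes c: "c \<in> carrier pair_ring" shows "End0_act (End0_class c) = frag_act c"
proof
  fix v
  interpret ideal tens_ideal pair_ring by (rule ideal_tens_ideal)
  define d where "d = inv_into (carrier pair_ring) End0_class (End0_class c)"
  have d: "d \<in> carrier pair_ring" "End0_class c = End0_class d"
    using c by (simp_all add: d_def inv_into_into f_inv_into_f)
  have "c \<in> End0_class d" using a_rcos_self[OF c] d(2) by (simp add: End0_class_def)
  then obtain i where "i \<in> tens_ideal" "c = i + d"
    by (auto simp: End0_class_def a_r_coset_def' free_pair_ring_simps)
  then have "frag_act c v = frag_act d v" using frag_act_tens_ideal by (simp add: frag_act_simps)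
  then show "End0_act (End0_class c) v = frag_act c v" by (simp add: End0_act_def d_def)
qed

lemma End0_act_hom:
  assumes \<xi>: "\<xi> \<in> carrier (torus_End0 \<Gamma>)" and \<eta>: "\<eta> \<in> carrier (torus_End0 \<Gamma>)"
  shows "End0_act (\<xi> \<otimes>\<^bsub>torus_End0 \<Gamma>\<^esub> \<eta>) v = End0_act \<xi> (End0_act \<eta> v)"
    and "End0_act (\<xi> \<oplus>\<^bsub>torus_End0 \<Gamma>\<^esub> \<eta>) v = End0_act \<xi> v + End0_act \<eta> v"
proof -
  interpret ring pair_ring by (rule ring_pair_ring)
  obtain c d where c: "c \<in> carrier pair_ring" "\<xi> = End0_class c" and d: "d \<in> carrier pair_ring" "\<eta> = End0_class d"
    using \<xi> \<eta> by (auto simp: carrier_End0)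
  show "End0_act (\<xi> \<otimes>\<^bsub>torus_End0 \<Gamma>\<^esub> \<eta>) v = End0_act \<xi> (End0_act \<eta> v)"
    using End0_act_class[OF m_closed[OF c(1) d(1)]] ring_hom_mult[OF End0_class_hom c(1) d(1)]
    by (simp add: c d End0_act_class frag_act_mult)
  show "End0_act (\<xi> \<oplus>\<^bsub>torus_End0 \<Gamma>\<^esub> \<eta>) v = End0_act \<xi> v + End0_act \<eta> v"
    using End0_act_class[OF a_closed[OF c(1) d(1)]] ring_hom_add[OF End0_class_hom c(1) d(1)]
    by (simp add: c d End0_act_class frag_act_simps free_pair_ring_simps(5))
qed

lemma End0_act_complex_linear: "\<xi> \<in> carrier (torus_End0 \<Gamma>) \<Longrightarrow> complex_linear (End0_act \<xi>)"
  by (auto simp: carrier_End0 End0_act_class frag_act_complex_linear)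

lemma End0_act_rat_span:
  "\<xi> \<in> carrier (torus_End0 \<Gamma>) \<Longrightarrow> x \<in> rat_vs.span \<Gamma> \<Longrightarrow> End0_act \<xi> x \<in> rat_vs.span \<Gamma>"
  by (auto simp: carrier_End0 End0_act_class frag_act_rat_span)

lemma End0_act_one: "End0_act \<one>\<^bsub>torus_End0 \<Gamma>\<^esub> v = v"
proof -
  interpret ring pair_ring by (rule ring_pair_ring)
  show ?thesis
    unfolding ring_hom_one[OF End0_class_hom, symmetric] End0_act_class[OF one_closed]
    by (simp add: free_pair_ring_simps frag_act_simps rat_ring_simps lift_of_one)
qed

definition scalar :: "rat \<Rightarrow> ((('v set \<Rightarrow> 'v set) \<times> rat) \<Rightarrow>\<^sub>0 int) set" where
  "scalar q = End0_class (frag_of (\<one>\<^bsub>torus_End \<Gamma>\<^esub>, q))"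

lemma torus_End0_rat_eq: "torus_End0_rat \<Gamma> = range scalar"
  by (simp add: torus_End0_rat_def pure_tensor_def scalar_def[abs_def] End0_class_def tens_ideal_def)

lemma scalar_frag: "frag_of (\<one>\<^bsub>torus_End \<Gamma>\<^esub>, q) \<in> carrier pair_ring"
  using monoid.one_closed[OF torus_End_monoid(1)[OF \<Gamma>]] by (simp add: keys_pair_ring)

lemma scalar_closed: "scalar q \<in> carrier (torus_End0 \<Gamma>)"
  using scalar_frag by (auto simp: scalar_def carrier_End0)

lemma End0_act_scalar: "End0_act (scalar q) v = of_rat q *\<^sub>R v"
  by (simp add: scalar_def End0_act_class[OF scalar_frag] frag_act_simps lift_of_one)

end

section \<open>The endomorphism field acting on the rational lattice\<close>

context complex_torus
begin

text \<open>The substantial condition is \<open>orbit_E\<close>. Evaluation at \<open>v0\<close> is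
  injective on the field, so its image has rational dimension \<open>card B\<close>, the same as the
  rational lattice containing it.\<close>

lemma simple_field_action_End0:
  assumes field: "Ring.field (torus_End0 \<Gamma>)"
    and dim: "ring.dimension (torus_End0 \<Gamma>) (card B) (torus_End0_rat \<Gamma>) (carrier (torus_End0 \<Gamma>))"
    and subf: "\<And>K. subfield K (torus_End0 \<Gamma>) \<Longrightarrow> K = torus_End0_rat \<Gamma> \<or> K = carrier (torus_End0 \<Gamma>)"
    and B: "finite B" "card B > 2" "independent B" "B \<subseteq> \<Gamma>" "\<Gamma> \<subseteq> rat_vs.span B" and v0: "v0 \<in> B"
  shows "simple_field_action (End0_act ` carrier (torus_End0 \<Gamma>)) B v0"
proof -
  define R where "R = torus_End0 \<Gamma>"
  interpret R: Ring.field R using field by (simp add: R_def)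
  define act where "act = End0_act"
  note act_mult = End0_act_hom(1)[folded R_def act_def] and act_add = End0_act_hom(2)[folded R_def act_def]
    and act_lin = End0_act_complex_linear[folded R_def act_def] and act_span = End0_act_rat_span[folded R_def act_def]
    and act_one = End0_act_one[folded R_def act_def]
    and act_scalar = End0_act_scalar[folded act_def] and scalar_closed' = scalar_closed[folded R_def]
  have span_eq: "rat_vs.span \<Gamma> = rat_vs.span B"
    using B(4,5) by (metis rat_vs.span_mono rat_vs.span_span subset_antisym)
  have v0_nz: "v0 \<noteq> 0" using B(3) v0 dependent_zero by blast
  have act_zero: "act \<zero>\<^bsub>R\<^esub> v = 0" for v
    using act_add[OF R.zero_closed R.zero_closed, of v] by simp
  have act_0: "act \<xi> 0 = 0" if "\<xi> \<in> carrier R" for \<xi>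
    using complex_linear_imp_linear[OF act_lin[OF that]] by (rule linear_0)
  have act_commute: "act \<xi> (act \<eta> v) = act \<eta> (act \<xi> v)" if "\<xi> \<in> carrier R" "\<eta> \<in> carrier R" for \<xi> \<eta> v
    using act_mult[OF that, of v] act_mult[OF that(2,1), of v] R.m_comm[OF that] by simp
  have inv_closed: "inv\<^bsub>R\<^esub> \<xi> \<in> carrier R"
    and act_inv: "act \<xi> (act (inv\<^bsub>R\<^esub> \<xi>) v) = v"
    if "\<xi> \<in> carrier R" "\<xi> \<noteq> \<zero>\<^bsub>R\<^esub>" for \<xi> v
  proof -
    have U: "\<xi> \<in> Units R" using that by (simp add: R.field_Units)
    then show c: "inv\<^bsub>R\<^esub> \<xi> \<in> carrier R" by (rule R.Units_inv_closed)
    show "act \<xi> (act (inv\<^bsub>R\<^esub> \<xi>) v) = v"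
      using act_mult[OF that(1) c, of v] R.Units_r_inv[OF U] by (simp add: act_one)
  qed
  have act_uminus: "act (\<ominus>\<^bsub>R\<^esub> \<xi>) v = - act \<xi> v" if "\<xi> \<in> carrier R" for \<xi> v
    using act_add[of \<xi> "\<ominus>\<^bsub>R\<^esub> \<xi>" v] that by (simp add: R.r_neg act_zero eq_neg_iff_add_eq_0 add.commute)
  \<comment> \<open>A nonzero \<open>\<zeta>\<close> killing \<open>v0\<close> would force
    \<open>v0 = 0\<close>, because its inverse commutes with it.\<close>
  have inj: "\<xi> = \<eta>" if \<xi>: "\<xi> \<in> carrier R" and \<eta>: "\<eta> \<in> carrier R" and eq: "act \<xi> v0 = act \<eta> v0" for \<xi> \<eta>
  proof (rule ccontr)
    assume ne: "\<xi> \<noteq> \<eta>"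
    define \<zeta> where "\<zeta> = \<xi> \<ominus>\<^bsub>R\<^esub> \<eta>"
    have \<zeta>: "\<zeta> \<in> carrier R" "\<zeta> \<noteq> \<zero>\<^bsub>R\<^esub>" using \<xi> \<eta> ne by (simp_all add: \<zeta>_def)
    have "act \<zeta> v0 = 0" using act_add[OF \<xi> R.a_inv_closed[OF \<eta>]] \<eta> eq
      by (simp add: \<zeta>_def a_minus_def act_uminus)
    then have "v0 = 0" using act_inv[OF \<zeta>, of v0] act_commute[OF \<zeta>(1) inv_closed[OF \<zeta>]] act_0[OF inv_closed[OF \<zeta>]] by simp
    then show False using v0_nz by simp
  qed
  \<comment> \<open>The induction follows the construction of the dimension and carries along a
    rational basis of the image. The equation for \<open>K\<close> stays a premise because the
    induction generalises \<open>K\<close>.\<close>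
  have "K = range scalar \<Longrightarrow> M \<subseteq> carrier R \<and>
      (\<exists>S. finite S \<and> card S = n \<and> rat_vs.independent S \<and> rat_vs.span S = (\<lambda>\<xi>. act \<xi> v0) ` M)"
    if "R.dimension n K M" for n K M
    using that
  proof (induction rule: R.dimension.induct)
    case (zero_dim K)
    show ?case
      by (intro conjI exI[of _ "{}"]) (auto simp: act_zero rat_vs.independent_empty)
  next
    case (Suc_dim v M n K)
    then obtain S where M: "M \<subseteq> carrier R" and S: "finite S" "card S = n" "rat_vs.independent S"
      and span: "rat_vs.span S = (\<lambda>\<xi>. act \<xi> v0) ` M" by blast
    \<comment> \<open>Since \<open>v\<close> lies outside \<open>M\<close>, injectivity of
      evaluation makes \<open>act v v0\<close> a new direction.\<close>
    have new: "act v v0 \<notin> rat_vs.span S"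
      using inj Suc_dim.hyps M unfolding span by blast
    have mem: "\<xi> \<in> R.line_extension K v M \<longleftrightarrow> (\<exists>q. \<exists>m\<in>M. \<xi> = scalar q \<otimes>\<^bsub>R\<^esub> v \<oplus>\<^bsub>R\<^esub> m)" for \<xi>
      unfolding R.line_extension_mem_iff Suc_dim.prems by blast
    have act_mem: "act (scalar q \<otimes>\<^bsub>R\<^esub> v \<oplus>\<^bsub>R\<^esub> m) v0 = of_rat q *\<^sub>R act v v0 + act m v0" if "m \<in> M" for q m
      using that M Suc_dim.hyps(1) by (simp add: act_add act_mult act_scalar scalar_closed' subsetD)
    have "(\<lambda>\<xi>. act \<xi> v0) ` R.line_extension K v M = rat_vs.span (insert (act v v0) S)"
    proof (intro subset_antisym subsetI)
      fix x assume "x \<in> (\<lambda>\<xi>. act \<xi> v0) ` R.line_extension K v M"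
      then obtain q m where m: "m \<in> M" and "x = act (scalar q \<otimes>\<^bsub>R\<^esub> v \<oplus>\<^bsub>R\<^esub> m) v0"
        unfolding image_iff Bex_def mem by blast
      then have "x = of_rat q *\<^sub>R act v v0 + act m v0" by (simp add: act_mem)
      moreover have "act m v0 \<in> rat_vs.span S" unfolding span using m by blast
      ultimately show "x \<in> rat_vs.span (insert (act v v0) S)"
        unfolding rat_vs.span_insert by (auto intro!: exI[of _ q])
    next
      fix x assume "x \<in> rat_vs.span (insert (act v v0) S)"
      then obtain q where "x - of_rat q *\<^sub>R act v v0 \<in> rat_vs.span S"
        unfolding rat_vs.span_insert by blast
      then obtain m where m: "m \<in> M" "x - of_rat q *\<^sub>R act v v0 = act m v0" unfolding span by blast
      then have "x = act (scalar q \<otimes>\<^bsub>R\<^esub> v \<oplus>\<^bsub>R\<^esub> m) v0" by (simp add: act_mem algebra_simps)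
      moreover have "scalar q \<otimes>\<^bsub>R\<^esub> v \<oplus>\<^bsub>R\<^esub> m \<in> R.line_extension K v M" using mem m by blast
      ultimately show "x \<in> (\<lambda>\<xi>. act \<xi> v0) ` R.line_extension K v M" by blast
    qed
    moreover have "R.line_extension K v M \<subseteq> carrier R"
    proof
      fix \<xi> assume "\<xi> \<in> R.line_extension K v M"
      then obtain q m where "m \<in> M" "\<xi> = scalar q \<otimes>\<^bsub>R\<^esub> v \<oplus>\<^bsub>R\<^esub> m" unfolding mem by blast
      then show "\<xi> \<in> carrier R" using M Suc_dim.hyps(1) scalar_closed' by auto
    qed
    moreover have "act v v0 \<notin> S" using new rat_vs.span_base by blast
    ultimately show ?case
      using S new by (intro conjI exI[of _ "insert (act v v0) S"]) (simp_all add: rat_vs.independent_insertI)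
  qed
  from this[OF dim[folded R_def] torus_End0_rat_eq] obtain S where
    S: "finite S" "card S = card B" "rat_vs.independent S" "rat_vs.span S = (\<lambda>\<xi>. act \<xi> v0) ` carrier R" by blast
  have "v0 \<in> rat_vs.span B" using v0 by (rule rat_vs.span_base)
  then have sub: "(\<lambda>\<xi>. act \<xi> v0) ` carrier R \<subseteq> rat_vs.span B"
    using act_span unfolding span_eq by blast
  have "S \<subseteq> rat_vs.span B" using rat_vs.span_superset[of S] S(4) sub by blast
  \<comment> \<open>\<open>S\<close> is independent with as many elements as \<open>B\<close>, so
    its span fills the rational lattice.\<close>
  then have "rat_vs.span B \<subseteq> rat_vs.span S"
    using rat_vs.span_subset_of_card_le[OF S(3) B(1)] S(2) by simp
  then have orbit: "(\<lambda>\<xi>. act \<xi> v0) ` carrier R = rat_vs.span B" using S(4) sub by simp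
  have scale: "act (scalar q \<otimes>\<^bsub>R\<^esub> \<xi>) = (\<lambda>x. of_rat q *\<^sub>R act \<xi> x)" if "\<xi> \<in> carrier R" for q \<xi>
    using that by (simp add: fun_eq_iff act_mult act_scalar scalar_closed')
  have "simple_field_action (act ` carrier R) B v0"
  proof (unfold_locales)
    show "finite B" "2 < card B" "independent B" "v0 \<in> B" by fact+
    show "(\<lambda>f. f v0) ` act ` carrier R = rat_vs.span B" using orbit by (simp add: image_image)
    show "(\<lambda>x. x) \<in> act ` carrier R" by (rule image_eqI[OF _ R.one_closed]) (simp add: act_one fun_eq_iff)
  next
    fix f q assume "f \<in> act ` carrier R"
    then obtain \<xi> where \<xi>: "\<xi> \<in> carrier R" "f = act \<xi>" by blast
    then show "complex_linear f" by (simp add: act_lin)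
    show "(\<lambda>x. of_rat q *\<^sub>R f x) \<in> act ` carrier R"
      by (rule image_eqI[OF _ R.m_closed[OF scalar_closed' \<xi>(1)]]) (simp add: \<xi> scale)
    show "\<exists>h\<in>act ` carrier R. \<forall>x. f (h x) = x" if "f \<noteq> (\<lambda>x. 0)"
    proof -
      have nz: "\<xi> \<noteq> \<zero>\<^bsub>R\<^esub>" using that \<xi>(2) by (auto simp: act_zero)
      show ?thesis
        by (rule bexI[OF _ imageI[OF inv_closed[OF \<xi>(1) nz]]]) (simp add: \<xi>(2) act_inv[OF \<xi>(1) nz])
    qed
    fix h assume "h \<in> act ` carrier R"
    then obtain \<eta> where \<eta>: "\<eta> \<in> carrier R" "h = act \<eta>" by blast
    show "(\<lambda>x. f x + h x) \<in> act ` carrier R"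
      by (rule image_eqI[OF _ R.a_closed[OF \<xi>(1) \<eta>(1)]]) (simp add: \<xi> \<eta> act_add fun_eq_iff)
    show "(\<lambda>x. f (h x)) \<in> act ` carrier R"
      by (rule image_eqI[OF _ R.m_closed[OF \<xi>(1) \<eta>(1)]]) (simp add: \<xi> \<eta> act_mult fun_eq_iff)
    show "f (h x) = h (f x)" for x using \<xi> \<eta> act_commute by simp
  next
    fix K assume K: "K \<subseteq> act ` carrier R" and K1: "(\<lambda>x. x) \<in> K"
      and Kadd: "\<And>f h. f \<in> K \<Longrightarrow> h \<in> K \<Longrightarrow> (\<lambda>x. f x + h x) \<in> K"
      and Kscale: "\<And>f q. f \<in> K \<Longrightarrow> (\<lambda>x. of_rat q *\<^sub>R f x) \<in> K"
      and Kmult: "\<And>f h. f \<in> K \<Longrightarrow> h \<in> K \<Longrightarrow> (\<lambda>x. f (h x)) \<in> K"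
      and Kinv: "\<And>f h. f \<in> K \<Longrightarrow> h \<in> act ` carrier R \<Longrightarrow> \<forall>x. f (h x) = x \<Longrightarrow> h \<in> K"
    \<comment> \<open>The hypothesis speaks of subfields of \<open>R\<close>, so the set of maps
      \<open>K\<close> is pulled back along the action.\<close>
    define K' where "K' = {\<xi> \<in> carrier R. act \<xi> \<in> K}"
    have KK': "K = act ` K'" using K by (auto simp: K'_def)
    have "subfield K' R"
    proof (rule R.subfieldI'[OF R.subringI])
      show "K' \<subseteq> carrier R" by (auto simp: K'_def)
      have "act \<one>\<^bsub>R\<^esub> = (\<lambda>x. x)" by (simp add: fun_eq_iff act_one)
      then show "\<one>\<^bsub>R\<^esub> \<in> K'" using K1 by (simp add: K'_def)
    next
      fix \<xi> assume "\<xi> \<in> K'"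
      then have \<xi>: "\<xi> \<in> carrier R" "act \<xi> \<in> K" by (auto simp: K'_def)
      \<comment> \<open>Negatives come from closure under rational multiples, with factor
        -1.\<close>
      have "act (\<ominus>\<^bsub>R\<^esub> \<xi>) = (\<lambda>x. of_rat (-1) *\<^sub>R act \<xi> x)"
        using \<xi> by (simp add: fun_eq_iff act_uminus of_rat_minus)
      then show "\<ominus>\<^bsub>R\<^esub> \<xi> \<in> K'" using \<xi> Kscale[OF \<xi>(2), of "-1"] by (simp add: K'_def)
    next
      fix \<xi> \<eta> assume "\<xi> \<in> K'" "\<eta> \<in> K'"
      then have \<xi>: "\<xi> \<in> carrier R" "act \<xi> \<in> K" and \<eta>: "\<eta> \<in> carrier R" "act \<eta> \<in> K" by (auto simp: K'_def)
      have "act (\<xi> \<otimes>\<^bsub>R\<^esub> \<eta>) = (\<lambda>x. act \<xi> (act \<eta> x))" "act (\<xi> \<oplus>\<^bsub>R\<^esub> \<eta>) = (\<lambda>x. act \<xi> x + act \<eta> x)"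
        using \<xi> \<eta> by (simp_all add: fun_eq_iff act_mult act_add)
      then show "\<xi> \<otimes>\<^bsub>R\<^esub> \<eta> \<in> K'" "\<xi> \<oplus>\<^bsub>R\<^esub> \<eta> \<in> K'"
        using \<xi> \<eta> Kmult[OF \<xi>(2) \<eta>(2)] Kadd[OF \<xi>(2) \<eta>(2)] by (simp_all add: K'_def)
    next
      fix \<xi> assume "\<xi> \<in> K' - {\<zero>\<^bsub>R\<^esub>}"
      then have \<xi>: "\<xi> \<in> carrier R" "\<xi> \<noteq> \<zero>\<^bsub>R\<^esub>" "act \<xi> \<in> K" by (auto simp: K'_def)
      have "act (inv\<^bsub>R\<^esub> \<xi>) \<in> K"
        by (rule Kinv[OF \<xi>(3) imageI[OF inv_closed[OF \<xi>(1,2)]]]) (simp add: act_inv[OF \<xi>(1,2)])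
      then show "inv\<^bsub>R\<^esub> \<xi> \<in> K'" using inv_closed \<xi> by (simp add: K'_def)
    qed
    then have "K' = range scalar \<or> K' = carrier R"
      using subf[folded R_def] by (simp add: torus_End0_rat_eq)
    moreover have "act (scalar q) = (\<lambda>x. of_rat q *\<^sub>R x)" for q
      by (simp add: fun_eq_iff act_scalar)
    then have "act ` range scalar = range (\<lambda>q x. of_rat q *\<^sub>R x)" by (simp add: image_image)
    ultimately show "K = range (\<lambda>q x. of_rat q *\<^sub>R x) \<or> K = act ` carrier R" using KK' by blast
  qed
  then show ?thesis by (simp add: R_def act_def)
qed

end

section \<open>Lattices and dual lattices\<close>

interpretation int_module: Modules.module "\<lambda>(k::int) (v::'a::real_vector). of_int k *\<^sub>R v"
  by unfold_locales (simp_all add: scaleR_add_right scaleR_add_left)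

text \<open>Simultaneous Dirichlet approximation, reindexed along a bijection from an initial
  segment of the naturals to \<open>C\<close>.\<close>

lemma dirichlet_simultaneous_finite:
  fixes r :: "'c \<Rightarrow> real" and e :: real
  assumes "finite C" "0 < e"
  obtains q :: int and p :: "'c \<Rightarrow> int" where "0 < q" "\<And>c. c \<in> C \<Longrightarrow> \<bar>of_int q * r c - of_int (p c)\<bar> < e"
proof -
  obtain h where h: "bij_betw h {0..<card C} C" using ex_bij_betw_nat_finite[OF assms(1)] by blast
  obtain N where N: "N > 0" "1 / real N < e"
    using nat_approx_posE[OF assms(2)] by (metis zero_less_Suc)
  obtain q p where qp: "0 < q" "\<And>i. i < card C \<Longrightarrow> \<bar>of_int q * r (h i) - of_int (p i)\<bar> < 1 / N"
    using Dirichlet_approx_simult[OF N(1), of "card C" "\<lambda>i. r (h i)"] by metis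
  have "\<bar>of_int q * r c - of_int (p (inv_into {0..<card C} h c))\<bar> < e" if c: "c \<in> C" for c
  proof -
    have "h (inv_into {0..<card C} h c) = c" "inv_into {0..<card C} h c < card C"
      using bij_betw_inv_into_right[OF h c] bij_betwE[OF bij_betw_inv_into[OF h]] c by auto
    then show ?thesis using qp(2)[of "inv_into {0..<card C} h c"] N(2) by simp
  qed
  with qp(1) show thesis by (rule that)
qed

text \<open>If \<open>b\<close> is a real combination of the other basis vectors, some multiple
  \<open>q b\<close> has nearly integral coefficients. Rounding them yields an element of
  \<open>\<Gamma>\<close> shorter than \<open>e\<close>, hence zero, and so an integer relation
  whose coefficient at \<open>b\<close> is \<open>q > 0\<close>.\<close>

lemma int_span_discrete_independent:
  fixes B :: "'v::real_normed_vector set"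
  assumes B: "finite B" and ind: "int_module.independent B" and \<Gamma>: "int_module.span B = \<Gamma>"
    and e: "e > 0" "\<And>x. x \<in> \<Gamma> \<Longrightarrow> norm x < e \<Longrightarrow> x = 0"
  shows "independent B"
proof
  assume "dependent B"
  then obtain b where b: "b \<in> B" "b \<in> span (B - {b})" by (auto simp: dependent_def)
  define C where "C = B - {b}"
  have C: "finite C" using B by (simp add: C_def)
  obtain r where r: "b = (\<Sum>c\<in>C. r c *\<^sub>R c)" using b(2) span_finite[OF C] by (auto simp: C_def)
  \<comment> \<open>The summand 1 makes \<open>N\<close> positive and leaves room for the strict
    bound \<open>norm x < e\<close>.\<close>
  define N where "N = (\<Sum>c\<in>C. norm c) + 1"
  have N: "N > 0" by (simp add: N_def sum_nonneg add_nonneg_pos)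
  obtain q :: int and p where q: "0 < q" and p: "\<And>c. c \<in> C \<Longrightarrow> \<bar>of_int q * r c - of_int (p c)\<bar> < e / N"
    using dirichlet_simultaneous_finite[OF C, of "e / N" r] e(1) N by auto
  define u where "u c = (if c = b then q else - p c)" for c
  define x where "x = (\<Sum>c\<in>B. of_int (u c) *\<^sub>R c)"
  have "x \<in> \<Gamma>" unfolding \<Gamma>[symmetric] x_def
    by (intro int_module.span_sum int_module.span_scale int_module.span_base)
  moreover have "norm x < e"
  proof -
    have "x = of_int q *\<^sub>R b + (\<Sum>c\<in>C. of_int (u c) *\<^sub>R c)"
      unfolding x_def C_def using sum.remove[OF B b(1), of "\<lambda>c. of_int (u c) *\<^sub>R c"] by (simp add: u_def)
    also have "(\<Sum>c\<in>C. of_int (u c) *\<^sub>R c) = (\<Sum>c\<in>C. - (of_int (p c) *\<^sub>R c))"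
      by (rule sum.cong) (auto simp: u_def C_def)
    also have "of_int q *\<^sub>R b = (\<Sum>c\<in>C. (of_int q * r c) *\<^sub>R c)"
      by (subst r) (simp add: scaleR_sum_right)
    finally have "x = (\<Sum>c\<in>C. (of_int q * r c - of_int (p c)) *\<^sub>R c)"
      by (simp add: scaleR_diff_left flip: sum.distrib)
    then have "norm x \<le> (\<Sum>c\<in>C. norm ((of_int q * r c - of_int (p c)) *\<^sub>R c))"
      by (simp only: norm_sum)
    also have "\<dots> \<le> (\<Sum>c\<in>C. e / N * norm c)"
    proof (rule sum_mono)
      fix c assume "c \<in> C"
      then show "norm ((of_int q * r c - of_int (p c)) *\<^sub>R c) \<le> e / N * norm c"
        unfolding norm_scaleR using p[of c] by (intro mult_right_mono) auto
    qed
    also have "\<dots> = e / N * (\<Sum>c\<in>C. norm c)" by (rule sum_distrib_left[symmetric])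
    also have "\<dots> = e / N * (N - 1)" by (simp add: N_def)
    also have "\<dots> < e / N * N" using e(1) N by (intro mult_strict_left_mono) auto
    finally show ?thesis using N by simp
  qed
  ultimately have "x = 0" using e(2) by blast
  then have "u b = 0"
    using int_module.independentD[OF ind B order_refl, of u b] b(1) by (simp add: x_def)
  then show False using q by (simp add: u_def)
qed

lemma is_lattice_basis:
  fixes \<Gamma> :: "'v::complex_normed_vector set"
  assumes "is_lattice n \<Gamma>"
  obtains B where "discrete_subgroup \<Gamma>" "finite B" "card B = n" "independent B" "B \<subseteq> \<Gamma>" "\<Gamma> \<subseteq> rat_vs.span B"
proof -
  obtain B where B: "finite B" "card B = n" "int_module.independent B" and span: "int_module.span B = \<Gamma>"
    and disc: "discrete \<Gamma>"
    using assms by (auto simp: is_lattice_def)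
  have z: "0 \<in> \<Gamma>" unfolding span[symmetric] by (rule int_module.span_zero)
  obtain e where e: "e > 0" "\<And>x. x \<in> \<Gamma> \<Longrightarrow> norm x < e \<Longrightarrow> x = 0"
    using discreteD[OF disc z] unfolding isolated_in_dist_Ex_iff by (auto simp: dist_norm)
  show thesis
  proof
    show "finite B" "card B = n" by fact+
    show "discrete_subgroup \<Gamma>"
      unfolding discrete_subgroup_def using z e int_module.span_diff span by blast
    show "independent B" using int_span_discrete_independent B span e by blast
    show "B \<subseteq> \<Gamma>" using span int_module.span_superset by blast
    have "int_module.subspace (rat_vs.span B)"
      using rat_vs.span_scale[of _ B "of_int _"]
      by (auto simp: int_module.subspace_def rat_vs.span_zero rat_vs.span_add)
    then show "\<Gamma> \<subseteq> rat_vs.span B"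
      unfolding span[symmetric] by (intro int_module.span_minimal rat_vs.span_superset)
  qed
qed

text \<open>A complex basis and its image under \<open>\<i>\<close> together span over the reals and
  have at most \<open>2 * g\<close> elements, so an independent set of size \<open>2 * g\<close>
  already spans.\<close>

lemma independent_card_eq_twice_complex_dim:
  fixes B :: "'v::complex_normed_vector set"
  assumes dim: "complex_dim TYPE('v) = g" and g: "g > 0"
    and B: "independent B" "card B = 2 * g"
  shows "span B = UNIV"
proof -
  interpret C: vector_space "scaleC :: complex \<Rightarrow> 'v \<Rightarrow> 'v"
    by unfold_locales
       (simp_all add: scaleC_add_right scaleC_add_left scaleC_scaleC, metis scaleR_one scaleR_scaleC of_real_1)
  obtain A :: "'v set" where A: "UNIV \<subseteq> C.span A" "card A = g"
    using C.basis_exists[of UNIV] dim by (auto simp: complex_dim_def)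
  \<comment> \<open>Positivity of \<open>g\<close> matters: an infinite set also has
    \<open>card\<close> 0.\<close>
  have fA: "finite A" using A(2) g card_gt_0_iff by blast
  define T where "T = A \<union> (scaleC \<i>) ` A"
  have T: "finite T" using fA by (simp add: T_def)
  have linear_i: "linear ((*\<^sub>C) \<i> :: 'v \<Rightarrow> 'v)"
    by (rule linearI) (simp_all add: scaleC_add_right scaleR_scaleC scaleC_scaleC mult.commute)
  have i: "\<i> *\<^sub>C x \<in> span T" if "x \<in> span T" for x
  proof -
    have "scaleC \<i> ` T \<subseteq> span T"
    proof -
      have "\<i> *\<^sub>C \<i> *\<^sub>C a = - a" for a :: 'v
        using scaleR_scaleC[of "-1" a] by (simp add: scaleC_scaleC)
      then show ?thesis by (auto simp: T_def span_base span_neg)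
    qed
    then have "span (scaleC \<i> ` T) \<subseteq> span T" by (intro span_minimal) auto
    then show ?thesis using that linear_span_image[OF linear_i, of T] by blast
  qed
  have "C.subspace (span T)"
  proof (rule C.subspaceI)
    fix c x assume x: "x \<in> span T"
    have "c *\<^sub>C x = (complex_of_real (Re c) + complex_of_real (Im c) * \<i>) *\<^sub>C x"
      by (metis complex_eq mult.commute)
    also have "\<dots> = Re c *\<^sub>R x + Im c *\<^sub>R (\<i> *\<^sub>C x)"
      by (simp add: scaleC_add_left scaleR_scaleC scaleC_scaleC)
    also have "\<dots> \<in> span T" using x i by (intro span_add span_scale)
    finally show "c *\<^sub>C x \<in> span T" .
  qed (auto simp: span_zero span_add)
  then have "C.span A \<subseteq> span T" by (intro C.span_minimal) (auto simp: T_def span_base)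
  then have TU: "span T = UNIV" using A by blast
  have "card T \<le> card A + card (scaleC \<i> ` A)" unfolding T_def by (rule card_Un_le)
  also have "\<dots> \<le> 2 * g" using card_image_le[OF fA, of "scaleC \<i>"] A(2) by simp
  finally have "span T \<subseteq> span B"
    using real_vector.span_subset_of_card_le[OF B(1) T] B(2) TU by simp
  then show ?thesis using TU by blast
qed

section \<open>The antilinear dual and its lattice\<close>

lemma antidual_apply_linear: "linear (antidual_apply l)"
  by transfer (simp add: linear_conv_bounded_linear blinfun.bounded_linear_right bounded_linear.linear)

lemma antidual_apply_left:
  "antidual_apply (l + m) v = antidual_apply l v + antidual_apply m v"
  "antidual_apply (l - m) v = antidual_apply l v - antidual_apply m v"
  "antidual_apply (r *\<^sub>R l) v = r *\<^sub>R antidual_apply l v"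
  "antidual_apply 0 v = 0"
  by (transfer; simp add: blinfun.add_left blinfun.diff_left blinfun.scaleR_left)+

lemma norm_antidual_apply: "norm (antidual_apply l v) \<le> norm l * norm v"
  by transfer (rule norm_blinfun)

lemma antidual_eqI: "(\<And>v. antidual_apply l v = antidual_apply m v) \<Longrightarrow> l = m"
  by transfer (rule blinfun_eqI)

text \<open>By antilinearity the imaginary part of \<open>l\<close> at
  \<open>\<i> *\<^sub>C v\<close> is minus the real part at \<open>v\<close>. Hence an imaginary
  part vanishing everywhere forces the real part to vanish too.\<close>

lemma antidual_eq_0:
  assumes B: "span B = UNIV" and l: "\<And>b. b \<in> B \<Longrightarrow> Im (antidual_apply l b) = 0"
  shows "l = 0"
proof (rule antidual_eqI)
  fix v
  interpret linear "antidual_apply l" by (rule antidual_apply_linear)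
  have "span B \<subseteq> {v. Im (antidual_apply l v) = 0}"
    by (rule span_minimal) (auto simp: l subspace_def add scaleR zero)
  then have Im: "Im (antidual_apply l v) = 0" for v using B by blast
  from Im[of v] Im[of "\<i> *\<^sub>C v"] show "antidual_apply l v = antidual_apply 0 v"
    by (simp add: antidual_apply_scaleC antidual_apply_left complex_eq_iff)
qed

text \<open>If \<open>norm l < 1 / M\<close>, the integers \<open>Im (antidual_apply l b)\<close>
  for \<open>b\<close> in \<open>B\<close> have absolute value below 1 and so vanish, which forces
  \<open>l = 0\<close>.\<close>

lemma discrete_subgroup_dual_lattice:
  assumes "finite B" "B \<subseteq> \<Gamma>" "span B = UNIV"
  shows "discrete_subgroup (dual_lattice \<Gamma>)"
  unfolding discrete_subgroup_def
proof (intro conjI ballI)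
  show "0 \<in> dual_lattice \<Gamma>" by (simp add: dual_lattice_def antidual_apply_left)
  show "x - y \<in> dual_lattice \<Gamma>" if "x \<in> dual_lattice \<Gamma>" "y \<in> dual_lattice \<Gamma>" for x y
    using that by (auto simp: dual_lattice_def antidual_apply_left)
  define M where "M = (\<Sum>b\<in>B. norm b) + 1"
  have M: "M > 0" by (simp add: M_def sum_nonneg add_nonneg_pos)
  have "l = 0" if l: "l \<in> dual_lattice \<Gamma>" "norm l < 1 / M" for l
  proof (rule antidual_eq_0[OF assms(3)])
    fix b assume b: "b \<in> B"
    have "norm b \<le> M" using member_le_sum[OF b, of norm] assms(1) by (simp add: M_def)
    have "\<bar>Im (antidual_apply l b)\<bar> \<le> norm (antidual_apply l b)" by (rule abs_Im_le_cmod)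
    also have "\<dots> \<le> norm l * norm b" by (rule norm_antidual_apply)
    also have "\<dots> \<le> norm l * M" using \<open>norm b \<le> M\<close> by (intro mult_left_mono) auto
    also have "\<dots> < 1" using l(2) M by (simp add: field_simps)
    finally have "\<bar>Im (antidual_apply l b)\<bar> < 1" .
    moreover have "Im (antidual_apply l b) \<in> \<int>" using l(1) b assms(2) by (auto simp: dual_lattice_def)
    ultimately show "Im (antidual_apply l b) = 0" by (metis Ints_nonzero_abs_less1)
  qed
  then show "\<exists>e>0. \<forall>x\<in>dual_lattice \<Gamma>. norm x < e \<longrightarrow> x = 0" using M by (intro exI[of _ "1 / M"]) auto
qed

text \<open>A segment shorter than the separation radius injects into the torus. This rules out the
  zero homomorphism as an isogeny, since its kernel is the whole torus.\<close>

lemma infinite_torus: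
  fixes \<Gamma> :: "'v::complex_normed_vector set" and b :: 'v
  assumes \<Gamma>: "discrete_subgroup \<Gamma>" and b: "b \<noteq> 0"
  shows "infinite (carrier (torus \<Gamma>))"
proof -
  obtain e where e: "e > 0" "\<And>x. x \<in> \<Gamma> \<Longrightarrow> norm x < e \<Longrightarrow> x = 0"
    using \<Gamma> by (auto simp: discrete_subgroup_def)
  define c where "c = (e / (2 * norm b)) *\<^sub>R b"
  have c: "norm c < e" "c \<noteq> 0" using e(1) b by (simp_all add: c_def)
  have "inj_on (\<lambda>t. torus_proj \<Gamma> (t *\<^sub>R c)) {0..1}"
  proof (rule inj_onI)
    fix s t :: real assume st: "s \<in> {0..1}" "t \<in> {0..1}" and eq: "torus_proj \<Gamma> (s *\<^sub>R c) = torus_proj \<Gamma> (t *\<^sub>R c)"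
    have "(s - t) *\<^sub>R c \<in> \<Gamma>" using eq by (simp add: torus_proj_eq_iff[OF \<Gamma>] scaleR_diff_left)
    moreover have "norm ((s - t) *\<^sub>R c) < e"
      using mult_right_mono[of "\<bar>s - t\<bar>" 1 "norm c"] st c(1) by (simp add: abs_le_iff)
    ultimately have "(s - t) *\<^sub>R c = 0" using e(2) by blast
    then show "s = t" using c(2) by simp
  qed
  then have "infinite ((\<lambda>t. torus_proj \<Gamma> (t *\<^sub>R c)) ` {0..1::real})"
    by (simp add: finite_image_iff)
  then show ?thesis by (rule infinite_super[rotated]) (auto simp: torus_carrier)
qed

section \<open>Vanishing of the homomorphism group\<close>

theorem proposition1p8:
  fixes \<Gamma> :: "'v::complex_normed_vector set" and g :: nat
  assumes "g \<ge> 2"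
    and "complex_dim TYPE('v) = g"
    and "is_lattice (2 * g) \<Gamma>"
    and "Ring.field (torus_End0 \<Gamma>)"
    and "ring.dimension (torus_End0 \<Gamma>) (2 * g) (torus_End0_rat \<Gamma>) (carrier (torus_End0 \<Gamma>))"
    and "\<forall>K. subfield K (torus_End0 \<Gamma>) \<longrightarrow>
           K = torus_End0_rat \<Gamma> \<or> K = carrier (torus_End0 \<Gamma>)"
  shows "torus_Hom \<Gamma> (dual_lattice \<Gamma>) = {torus_zero_hom \<Gamma> (dual_lattice \<Gamma>)} \<and>
         \<not> torus_isogenous \<Gamma> (dual_lattice \<Gamma>)"
proof -
  obtain B where \<Gamma>: "discrete_subgroup \<Gamma>" and B: "finite B" "card B = 2 * g" "independent B"
    "B \<subseteq> \<Gamma>" "\<Gamma> \<subseteq> rat_vs.span B"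
    using is_lattice_basis[OF assms(3)] by blast
  have span_B: "span B = UNIV"
    using independent_card_eq_twice_complex_dim[OF assms(2) _ B(3,2)] assms(1) by simp
  have dual: "discrete_subgroup (dual_lattice \<Gamma>)"
    using discrete_subgroup_dual_lattice B span_B by blast
  have "B \<noteq> {}" using B(2) assms(1) by auto
  then obtain v0 where v0: "v0 \<in> B" by blast
  then have v0_nz: "v0 \<noteq> 0" using B(3) dependent_zero by blast
  interpret complex_torus \<Gamma> by unfold_locales (rule \<Gamma>)
  \<comment> \<open>Here \<open>g \<ge> 2\<close> supplies \<open>card B > 2\<close>.\<close>
  interpret simple_field_action "End0_act ` carrier (torus_End0 \<Gamma>)" B v0
    using simple_field_action_End0[of B v0] assms(1,4-6) B v0 by simp
  let ?Z = "torus_zero_hom \<Gamma> (dual_lattice \<Gamma>)"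
  have Z: "?Z \<in> torus_Hom \<Gamma> (dual_lattice \<Gamma>)"
    by (rule torus_lift_imp_Hom[OF \<Gamma> dual torus_zero_hom_lift]) (simp add: torus_zero_hom_def)
  have "f = ?Z" if f: "f \<in> torus_Hom \<Gamma> (dual_lattice \<Gamma>)" for f
  proof -
    obtain L where L: "torus_lift \<Gamma> (dual_lattice \<Gamma>) f L" using torus_Hom_imp_lift[OF \<Gamma> dual f] by blast
    then have cL: "complex_linear L" by (simp add: torus_lift_def)
    interpret L: linear L using cL by (rule complex_linear_imp_linear)
    \<comment> \<open>This form is integral on \<open>\<Gamma>\<close> because \<open>L\<close> maps
      into the dual lattice, and skew for \<open>\<i>\<close> because \<open>L\<close> is complex
      linear with antilinear values.\<close>
    define \<beta> where "\<beta> x y = Im (antidual_apply (L x) y)" for x y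
    have bil: "bilinear \<beta>"
      unfolding bilinear_def \<beta>_def
      by (intro conjI allI linearI)
         (simp_all add: L.add L.scaleR antidual_apply_left linear_add[OF antidual_apply_linear]
           linear_scale[OF antidual_apply_linear])
    have "\<beta> x y = 0" if "x \<in> rat_vs.span B" "y \<in> rat_vs.span B" for x y
    proof (rule rational_sesquilinear_form_zero[OF span_B bil _ _ that])
      show "\<beta> (\<i> *\<^sub>C x) y = - \<beta> x (\<i> *\<^sub>C y)" for x y
        using cL by (simp add: \<beta>_def complex_linear_def antidual_apply_scaleC antidual_apply_scaleC_left)
      \<comment> \<open>Rationality spreads from \<open>B\<close> to its rational span one variable
        at a time, since the vectors with rational values form a rational subspace.\<close>
      have rat_sub: "rat_vs.subspace {x. \<beta> x y \<in> \<rat>}" "rat_vs.subspace {x. \<beta> y x \<in> \<rat>}" for y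
        using bil by (auto simp: rat_vs.subspace_def bilinear_lzero bilinear_rzero bilinear_ladd bilinear_radd
            bilinear_lmul bilinear_rmul)
      have "\<beta> x y \<in> \<rat>" if "x \<in> B" "y \<in> B" for x y
        using torus_lift_mem[OF \<Gamma> dual L, of x] that B(4) Ints_subset_Rats by (auto simp: \<beta>_def dual_lattice_def)
      then have "\<beta> x y \<in> \<rat>" if "x \<in> B" "y \<in> rat_vs.span B" for x y
        using rat_vs.span_minimal[OF _ rat_sub(2)[of x], of B] that by blast
      then show "\<beta> x y \<in> \<rat>" if "x \<in> rat_vs.span B" "y \<in> rat_vs.span B" for x y
        using rat_vs.span_minimal[OF _ rat_sub(1)[of y], of B] that by blast
    qed
    \<comment> \<open>The imaginary part of \<open>L b\<close> vanishes on the real spanning set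
      \<open>B\<close>, which gives \<open>L b = 0\<close>; linearity then gives
      \<open>L = 0\<close>.\<close>
    then have "L b = 0" if "b \<in> B" for b
      using that by (intro antidual_eq_0[OF span_B]) (simp add: \<beta>_def rat_vs.span_base)
    then have "L x = 0" for x
      using linear_eq_0_on_span[OF L.linear_axioms, of B x] span_B by simp
    then have "L = (\<lambda>v. 0)" by blast
    then have "torus_lift \<Gamma> (dual_lattice \<Gamma>) ?Z L" by (simp only: torus_zero_hom_lift)
    then show ?thesis by (rule torus_Hom_eqI[OF f Z L])
  qed
  then have Hom: "torus_Hom \<Gamma> (dual_lattice \<Gamma>) = {?Z}" using Z by blast
  have "kernel (torus \<Gamma>) (torus (dual_lattice \<Gamma>)) ?Z = carrier (torus \<Gamma>)"
    by (auto simp: kernel_def torus_zero_hom_def)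
  then have "\<not> torus_isogenous \<Gamma> (dual_lattice \<Gamma>)"
    using infinite_torus[OF \<Gamma> v0_nz] by (simp add: torus_isogenous_def Hom)
  with Hom show ?thesis by blast
qed

end
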